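(* Let $\mu\geq0$ and work in $\mathbb{C}^2$, writing $z=x+iy$ with $x,y\in\mathbb{R}^2$. Then $$H\big(\widetilde{V_\mu^+}\cup T^+\cup T^-\big)=T^+\cup T^-\cup\{z\mid y^2<0,\ x\hat y>\mu\}\cup\{z\mid y^2=0,\ y\neq0,\ x_0>x_1\operatorname{sgn}y_0\operatorname{sgn}y_1\}\cup\{z\mid y=0,\ x\in V_\mu^+\}.$$
   Context: On $\mathbb{R}^2$ (and bilinearly on $\mathbb{C}^2$) use the Minkowski product $ab=a_0b_0-a_1b_1$, $a^2=aa$. $V^+=\{x\in\mathbb{R}^2: x^2>0,x_0>0\}$, $V^-=-V^+$, $V_\mu^+=\{x: x^2>\mu^2, x_0>0\}$. $T^\pm=\mathbb{R}^2+iV^\pm$ (forward/backward tube). For an open $B\subset\mathbb{R}^2$, $\widetilde B:=\bigcup_{x\in B}\{z\in\mathbb{C}^2:\|z-x\|<\tfrac1{32}\operatorname{dist}(x,\partial B)\}$. For a domain $G\subset\mathbb{C}^n$, $H(G)$ is its envelope of holomorphy (the smallest domain of holomorphy to which every holomorphic function on $G$ extends holomorphically). For spacelike $y\in\mathbb{R}^2$ ($y^2<0$), $\hat y$ is the unique vector with $\hat y^2=1$, $\hat yy=0$, $\hat y\in V^+$, namely $\hat y=\frac{\operatorname{sgn}y_1}{\sqrt{-y^2}}(y_1,y_0)$. *)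

theory Defs
  imports "HOL-Analysis.Analysis"
begin

definition mink :: "real \<times> real \<Rightarrow> real \<times> real \<Rightarrow> real" where
  "mink a b = fst a * fst b - snd a * snd b"

definition msq :: "real \<times> real \<Rightarrow> real" where
  "msq a = mink a a"

definition Vplus :: "(real \<times> real) set" where
  "Vplus = {x. msq x > 0 \<and> fst x > 0}"

definition Vminus :: "(real \<times> real) set" where
  "Vminus = uminus ` Vplus"

definition Vmu_plus :: "real \<Rightarrow> (real \<times> real) set" where
  "Vmu_plus \<mu> = {x. msq x > \<mu>\<^sup>2 \<and> fst x > 0}"

definition Re2 :: "complex \<times> complex \<Rightarrow> real \<times> real" where
  "Re2 z = (Re (fst z), Re (snd z))"

definition Im2 :: "complex \<times> complex \<Rightarrow> real \<times> real" where
  "Im2 z = (Im (fst z), Im (snd z))"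

definition emb2 :: "real \<times> real \<Rightarrow> complex \<times> complex" where
  "emb2 x = (complex_of_real (fst x), complex_of_real (snd x))"

definition Tplus :: "(complex \<times> complex) set" where
  "Tplus = {z. Im2 z \<in> Vplus}"

definition Tminus :: "(complex \<times> complex) set" where
  "Tminus = {z. Im2 z \<in> Vminus}"

definition tilde :: "(real \<times> real) set \<Rightarrow> (complex \<times> complex) set" where
  "tilde B = (\<Union>x\<in>B. {z. norm (z - emb2 x) < infdist x (frontier B) / 32})"

definition yhat :: "real \<times> real \<Rightarrow> real \<times> real" where
  "yhat y = (sgn (snd y) / sqrt (- msq y)) *\<^sub>R (snd y, fst y)"

definition holo2 :: "(complex \<times> complex \<Rightarrow> complex) \<Rightarrow> (complex \<times> complex) set \<Rightarrow> bool" where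
  "holo2 f S \<longleftrightarrow> (\<forall>z\<in>S. \<exists>a b. (f has_derivative (\<lambda>w. a * fst w + b * snd w)) (at z))"

definition domain2 :: "(complex \<times> complex) set \<Rightarrow> bool" where
  "domain2 D \<longleftrightarrow> open D \<and> connected D \<and> D \<noteq> {}"

text \<open>Domain of holomorphy (schlicht): no simultaneous holomorphic continuation
  of all functions across the boundary.\<close>
definition domain_of_holomorphy :: "(complex \<times> complex) set \<Rightarrow> bool" where
  "domain_of_holomorphy D \<longleftrightarrow> domain2 D \<and>
     \<not> (\<exists>U V. open U \<and> connected U \<and> open V \<and> V \<noteq> {} \<and> V \<subseteq> U \<inter> D \<and> \<not> U \<subseteq> D \<and>
          (\<forall>f. holo2 f D \<longrightarrow> (\<exists>g. holo2 g U \<and> (\<forall>z\<in>V. g z = f z))))"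

definition extends_all :: "(complex \<times> complex) set \<Rightarrow> (complex \<times> complex) set \<Rightarrow> bool" where
  "extends_all G E \<longleftrightarrow> (\<forall>f. holo2 f G \<longrightarrow> (\<exists>F. holo2 F E \<and> (\<forall>z\<in>G. F z = f z)))"

definition is_envelope :: "(complex \<times> complex) set \<Rightarrow> (complex \<times> complex) set \<Rightarrow> bool" where
  "is_envelope G E \<longleftrightarrow> G \<subseteq> E \<and> domain_of_holomorphy E \<and> extends_all G E \<and>
     (\<forall>D. domain_of_holomorphy D \<and> G \<subseteq> D \<and> extends_all G D \<longrightarrow> E \<subseteq> D)"

end

theory Submission
  imports Defs "HOL-Complex_Analysis.Conformal_Mappings"
begin

text \<open>
  In light-cone coordinates \<open>u = z\<^sub>0 + z\<^sub>1\<close>, \<open>v = z\<^sub>0 - z\<^sub>1\<close> the tubes are the products of two upper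
  and of two lower half planes, and \<open>V\<^sub>\<mu>\<^sup>+\<close> is the region above the hyperbola \<open>u v = \<mu>\<^sup>2\<close>.

  For \<open>\<bar>c\<bar> < 1\<close> the disc \<open>s \<mapsto> ((s + c) / (1 + c s), (s - c) / (1 - c s))\<close> maps the open upper and lower unit
  semicircles into the two tubes and fixes the corners \<open>\<plusminus>(1, 1)\<close>. Cauchy's integral over its boundary
  therefore extends every holomorphic function on the tubes and a neighbourhood of the diagonal segment
  (which is the disc \<open>c = 0\<close>) to the union of all these discs. Rescaled to
  squares with lower corner \<open>(\<alpha>, \<beta>)\<close> that grow to a quadrant, these extensions exhaust, up to points of
  the tubes and points over the quadrant, the domain where
  \<open>\<bar>Im u\<bar> (Re v - \<beta>) + \<bar>Im v\<bar> (Re u - \<alpha>) > 0\<close>; the union over \<open>\<alpha> \<beta> > \<mu>\<^sup>2\<close> is the asserted envelope by the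
  inequality of the arithmetic and geometric means. Extensions agree on overlaps because these are connected.

  Conversely each point outside the envelope lies on a complex line \<open>s u + r v = c\<close> with \<open>r, s \<ge> 0\<close> and
  real \<open>c \<le> 2 \<mu> \<surd>(r s)\<close>, and no such line meets the envelope, so \<open>1 / (s u + r v - c)\<close> is holomorphic there
  but singular at the point.
\<close>

subsection \<open>Holomorphic functions of two variables\<close>

lemma holo2_subset: "holo2 f S \<Longrightarrow> T \<subseteq> S \<Longrightarrow> holo2 f T"
  unfolding holo2_def by blast

lemma holo2_imp_continuous_on: "holo2 f S \<Longrightarrow> continuous_on S f"
  unfolding holo2_def
  by (meson continuous_at_imp_continuous_on has_derivative_continuous)

lemma holo2_transform:
  assumes "holo2 f S" "open S" "\<And>z. z \<in> S \<Longrightarrow> f z = g z"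
  shows "holo2 g S"
  unfolding holo2_def
proof
  fix z assume "z \<in> S"
  then obtain a b where "(f has_derivative (\<lambda>w. a * fst w + b * snd w)) (at z)"
    using assms(1) unfolding holo2_def by blast
  then have "(g has_derivative (\<lambda>w. a * fst w + b * snd w)) (at z)"
    by (rule has_derivative_transform_within_open) (use assms \<open>z \<in> S\<close> in auto)
  then show "\<exists>a b. (g has_derivative (\<lambda>w. a * fst w + b * snd w)) (at z)" by blast
qed

lemma holo2_pair_compose:
  assumes "holo2 f S" "holo2 g T" "holo2 h T" "\<And>z. z \<in> T \<Longrightarrow> (g z, h z) \<in> S"
  shows "holo2 (\<lambda>z. f (g z, h z)) T"
  unfolding holo2_def
proof
  fix z assume z: "z \<in> T"
  obtain a b where f: "(f has_derivative (\<lambda>w. a * fst w + b * snd w)) (at (g z, h z))"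
    using assms z unfolding holo2_def by blast
  obtain a1 b1 where g: "(g has_derivative (\<lambda>w. a1 * fst w + b1 * snd w)) (at z)"
    using assms z unfolding holo2_def by blast
  obtain a2 b2 where h: "(h has_derivative (\<lambda>w. a2 * fst w + b2 * snd w)) (at z)"
    using assms z unfolding holo2_def by blast
  have "((\<lambda>z. f (g z, h z)) has_derivative
      (\<lambda>w. a * fst (a1 * fst w + b1 * snd w, a2 * fst w + b2 * snd w)
         + b * snd (a1 * fst w + b1 * snd w, a2 * fst w + b2 * snd w))) (at z)"
    using has_derivative_compose[OF has_derivative_Pair[OF g h] f] by simp
  moreover have "(\<lambda>w. a * fst (a1 * fst w + b1 * snd w, a2 * fst w + b2 * snd w)
         + b * snd (a1 * fst w + b1 * snd w, a2 * fst w + b2 * snd w))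
     = (\<lambda>w. (a * a1 + b * a2) * fst w + (a * b1 + b * b2) * snd w)"
    by (auto simp: algebra_simps)
  ultimately show "\<exists>a b. ((\<lambda>z. f (g z, h z)) has_derivative (\<lambda>w. a * fst w + b * snd w)) (at z)"
    by metis
qed

lemma holo2_compose_field:
  assumes "holo2 g T" "\<And>z. z \<in> T \<Longrightarrow> f field_differentiable at (g z)"
  shows "holo2 (\<lambda>z. f (g z)) T"
  unfolding holo2_def
proof
  fix z assume z: "z \<in> T"
  obtain d where f: "(f has_derivative (\<lambda>w. d * w)) (at (g z))"
    using assms(2)[OF z] unfolding field_differentiable_def has_field_derivative_def by blast
  obtain a1 b1 where g: "(g has_derivative (\<lambda>w. a1 * fst w + b1 * snd w)) (at z)"
    using assms z unfolding holo2_def by blast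
  have "((\<lambda>z. f (g z)) has_derivative (\<lambda>w. d * (a1 * fst w + b1 * snd w))) (at z)"
    using has_derivative_compose[OF g f] .
  moreover have "(\<lambda>w. d * (a1 * fst w + b1 * snd w)) = (\<lambda>w. (d * a1) * fst w + (d * b1) * snd w)"
    by (auto simp: algebra_simps)
  ultimately show "\<exists>a b. ((\<lambda>z. f (g z)) has_derivative (\<lambda>w. a * fst w + b * snd w)) (at z)"
    by metis
qed

lemma holo2_const: "holo2 (\<lambda>z. c) S"
  unfolding holo2_def by (intro ballI exI[of _ 0]) simp

lemma holo2_fst: "holo2 fst S"
  unfolding holo2_def by (intro ballI exI[of _ 1] exI[of _ 0]) (auto intro!: derivative_eq_intros)

lemma holo2_snd: "holo2 snd S"
  unfolding holo2_def by (intro ballI exI[of _ 0] exI[of _ 1]) (auto intro!: derivative_eq_intros)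

lemma holo2_add_pair: "holo2 (\<lambda>z. fst z + snd z) S"
  unfolding holo2_def by (intro ballI exI[of _ 1]) (auto intro!: derivative_eq_intros)

lemma holo2_mult_pair: "holo2 (\<lambda>z. fst z * snd z) S"
  unfolding holo2_def
proof
  fix z :: "complex \<times> complex"
  have "((\<lambda>z. fst z * snd z) has_derivative (\<lambda>w. snd z * fst w + fst z * snd w)) (at z)"
    by (auto intro!: derivative_eq_intros simp: algebra_simps)
  then show "\<exists>a b. ((\<lambda>z. fst z * snd z) has_derivative (\<lambda>w. a * fst w + b * snd w)) (at z)" by blast
qed

lemma holo2_add: "holo2 f S \<Longrightarrow> holo2 g S \<Longrightarrow> holo2 (\<lambda>z. f z + g z) S"
  using holo2_pair_compose[OF holo2_add_pair[of UNIV], of f S g] by simp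

lemma holo2_mult: "holo2 f S \<Longrightarrow> holo2 g S \<Longrightarrow> holo2 (\<lambda>z. f z * g z) S"
  using holo2_pair_compose[OF holo2_mult_pair[of UNIV], of f S g] by simp

lemma holo2_minus: "holo2 f S \<Longrightarrow> holo2 (\<lambda>z. - f z) S"
  using holo2_mult[OF holo2_const[of "-1"], of f S] by simp

lemma holo2_diff: "holo2 f S \<Longrightarrow> holo2 g S \<Longrightarrow> holo2 (\<lambda>z. f z - g z) S"
  using holo2_add[OF _ holo2_minus, of f S g] by simp

lemma holo2_inverse: "holo2 f S \<Longrightarrow> (\<And>z. z \<in> S \<Longrightarrow> f z \<noteq> 0) \<Longrightarrow> holo2 (\<lambda>z. inverse (f z)) S"
  by (rule holo2_compose_field[where f = inverse]) (auto intro!: derivative_intros)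

lemma holo2_divide:
  "holo2 f S \<Longrightarrow> holo2 g S \<Longrightarrow> (\<And>z. z \<in> S \<Longrightarrow> g z \<noteq> 0) \<Longrightarrow> holo2 (\<lambda>z. f z / g z) S"
  unfolding divide_inverse by (intro holo2_mult holo2_inverse)

lemmas holo2_intros = holo2_const holo2_fst holo2_snd holo2_add holo2_mult holo2_minus holo2_diff
  holo2_inverse holo2_divide

lemma holo2_curve_holomorphic:
  assumes "holo2 f S" "g holomorphic_on T" "h holomorphic_on T" "open T"
    and "\<And>t. t \<in> T \<Longrightarrow> (g t, h t) \<in> S"
  shows "(\<lambda>t. f (g t, h t)) holomorphic_on T"
  unfolding holomorphic_on_open[OF \<open>open T\<close>]
proof
  fix t assume t: "t \<in> T"
  obtain a b where f: "(f has_derivative (\<lambda>w. a * fst w + b * snd w)) (at (g t, h t))"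
    using assms t unfolding holo2_def by blast
  obtain g' h' where g: "(g has_derivative (\<lambda>w. g' * w)) (at t)" and h: "(h has_derivative (\<lambda>w. h' * w)) (at t)"
    using assms(2-4) t unfolding holomorphic_on_open[OF \<open>open T\<close>] has_field_derivative_def by blast
  have "((\<lambda>t. f (g t, h t)) has_derivative (\<lambda>w. a * (g' * w) + b * (h' * w))) (at t)"
    using has_derivative_compose[OF has_derivative_Pair[OF g h] f] by simp
  also have "(\<lambda>w. a * (g' * w) + b * (h' * w)) = (\<lambda>w. (a * g' + b * h') * w)"
    by (auto simp: algebra_simps)
  finally show "\<exists>d. ((\<lambda>t. f (g t, h t)) has_field_derivative d) (at t)"
    unfolding has_field_derivative_def by blast
qed

text \<open>The complex line through \<open>z'\<close> and \<open>w\<close> reduces the claim to one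
  variable. The part of the line inside the ball is convex, hence connected, so the one-variable
  identity theorem carries the zeros near parameter 0 (in \<open>V\<close>) to parameter 1 (at
  \<open>w\<close>).\<close>

lemma holo2_eq_0_on_ball:
  assumes f: "holo2 f (ball z e)" and V: "open V" "z' \<in> V" "V \<subseteq> ball z e"
    and zero: "\<And>w. w \<in> V \<Longrightarrow> f w = 0" and w: "w \<in> ball z e"
  shows "f w = 0"
proof -
  define g where "g t = fst z' + t * (fst w - fst z')" for t :: complex
  define h where "h t = snd z' + t * (snd w - snd z')" for t :: complex
  define L where "L t = (g t, h t)" for t :: complex
  have affine: "L (u *\<^sub>R s + v *\<^sub>R t) = u *\<^sub>R L s + v *\<^sub>R L t" if "u + v = 1" for u v s t
  proof -
    have v: "v = 1 - u" using that by simp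
    show ?thesis unfolding v by (simp add: L_def g_def h_def scaleR_conv_of_real algebra_simps)
  qed
  have L0: "L 0 = z'" and L1: "L 1 = w" by (simp_all add: L_def g_def h_def)
  have contL: "continuous_on UNIV L" unfolding L_def g_def h_def by (intro continuous_intros)
  have "convex (L -` ball z e)"
    by (rule convexI, unfold vimage_eq affine) (rule convexD[OF convex_ball])
  moreover have o: "open (L -` ball z e)" "open (L -` V)"
    using contL V by (auto intro: open_vimage)
  moreover have "(\<lambda>t. f (g t, h t)) holomorphic_on (L -` ball z e)"
    using f o by (intro holo2_curve_holomorphic) (auto simp: g_def h_def L_def intro!: holomorphic_intros)
  ultimately have "f (g 1, h 1) = 0"
    using V zero w L0 L1
    by (intro analytic_continuation_open[of "L -` V" "L -` ball z e" "\<lambda>t. f (g t, h t)" "\<lambda>_. 0" 1])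
      (auto simp: L_def intro: convex_connected)
  then show ?thesis using L1 by (simp add: L_def)
qed

text \<open>Clopen argument for the interior \<open>Z\<close> of the zero set of the difference. A
  small ball around a limit point of \<open>Z\<close> meets the open set \<open>Z\<close>, and the
  preceding lemma makes the difference vanish on the whole ball.\<close>

lemma holo2_identity:
  assumes U: "open U" "connected U" and V: "open V" "V \<noteq> {}" "V \<subseteq> U"
    and f: "holo2 f U" and g: "holo2 g U" and eq: "\<And>z. z \<in> V \<Longrightarrow> f z = g z"
    and z: "z \<in> U"
  shows "f z = g z"
proof -
  define h where "h z = f z - g z" for z
  have h: "holo2 h U" unfolding h_def using f g by (rule holo2_diff)
  define Z where "Z = interior {z \<in> U. h z = 0}"
  have "open Z" by (simp add: Z_def)
  have "Z \<subseteq> U" unfolding Z_def using interior_subset by blast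
  have "V \<subseteq> Z" unfolding Z_def using V eq by (intro interior_maximal) (auto simp: h_def)
  have "openin (top_of_set U) Z" using \<open>open Z\<close> \<open>Z \<subseteq> U\<close> by (simp add: openin_open_eq U)
  moreover have "closedin (top_of_set U) Z"
  proof -
    have "y \<in> Z" if y: "y \<in> U" "y \<in> closure Z" for y
    proof -
      obtain e where e: "e > 0" "ball y e \<subseteq> U" using U y openE by blast
      obtain z' where z': "z' \<in> Z" "dist z' y < e" using y e by (meson closure_approachable)
      have "h w = 0" if "w \<in> ball y e" for w
      proof (rule holo2_eq_0_on_ball[of h y e "Z \<inter> ball y e" z' w])
        show "h x = 0" if "x \<in> Z \<inter> ball y e" for x
          using that interior_subset unfolding Z_def by blast
      qed (use e h z' that \<open>open Z\<close> in \<open>auto intro: holo2_subset simp: dist_commute\<close>)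
      then have "ball y e \<subseteq> Z" unfolding Z_def using e by (intro interior_maximal) auto
      then show ?thesis using e by auto
    qed
    then have "Z = U \<inter> closure Z" using \<open>Z \<subseteq> U\<close> closure_subset by blast
    then show ?thesis by (metis closed_closure closedin_closed)
  qed
  ultimately have "Z = U" using U(2) V \<open>V \<subseteq> Z\<close> unfolding connected_clopen by blast
  then have "h z = 0" using z interior_subset unfolding Z_def by blast
  then show ?thesis by (simp add: h_def)
qed

section \<open>Holomorphy of integrals depending on a parameter\<close>

text \<open>Cauchy's formula writes the derivative as an integral over the boundary circle whose
  integrand is jointly continuous in the point and the parameter. This supplies the continuity that
  differentiation under the integral sign asks for.\<close>

lemma continuous_on_deriv_param:
  fixes k :: "complex \<Rightarrow> 'p::topological_space \<Rightarrow> complex"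
  assumes cont: "continuous_on (cball c r \<times> P) (\<lambda>(w, p). k w p)"
    and hol: "\<And>p. p \<in> P \<Longrightarrow> (\<lambda>w. k w p) holomorphic_on ball c r"
  shows "continuous_on (ball c r \<times> P) (\<lambda>(w, p). deriv (\<lambda>w. k w p) w)"
proof (cases "r > 0")
  case True
  define \<gamma> where "\<gamma> = circlepath c r"
  define I where "I x t = k (\<gamma> t) (snd x) / (\<gamma> t - fst x)\<^sup>2 * (2 * pi * \<i> * r * exp (2 * pi * \<i> * t))"
    for x :: "complex \<times> 'p" and t :: real
  have \<gamma>: "\<gamma> t \<in> sphere c r" for t
    using True by (simp add: \<gamma>_def circlepath dist_norm norm_mult)
  have c\<gamma>: "continuous_on A \<gamma>" for A
    unfolding \<gamma>_def circlepath by (intro continuous_intros)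
  have deriv_eq: "deriv (\<lambda>w. k w p) w = 1 / (2 * pi * \<i>) * integral {0..1} (I (w, p))"
    if "w \<in> ball c r" "p \<in> P" for w p
  proof -
    have "continuous_on (cball c r) (\<lambda>w. k w p)"
      by (rule continuous_on_compose2[OF cont, of _ "\<lambda>w. (w, p)", simplified])
        (use that in \<open>auto intro!: continuous_intros\<close>)
    from Cauchy_derivative_integral_circlepath(2)[OF this hol[OF that(2)] that(1)]
    have "deriv (\<lambda>w. k w p) w
        = 1 / (2 * of_real pi * \<i>) * contour_integral (circlepath c r) (\<lambda>u. k u p / (u - w)\<^sup>2)"
      by (rule DERIV_imp_deriv)
    then show ?thesis
      by (simp add: contour_integral_integral I_def[abs_def] \<gamma>_def vector_derivative_circlepath)
  qed
  have "continuous_on (ball c r \<times> P) (\<lambda>x. integral (cbox 0 1) (I x))"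
  proof (rule integral_continuous_on_param)
    have "continuous_on ((ball c r \<times> P) \<times> cbox 0 1) (\<lambda>y. k (\<gamma> (snd y)) (snd (fst y)))"
      by (rule continuous_on_compose2[OF cont, of _ "\<lambda>y. (\<gamma> (snd y), snd (fst y))", simplified])
        (use \<gamma> in \<open>auto intro!: continuous_intros continuous_on_compose2[OF c\<gamma>] simp: dist_norm\<close>)
    moreover have "\<gamma> t - w \<noteq> 0" if "w \<in> ball c r" for t w
      using \<gamma>[of t] that by auto
    ultimately have "continuous_on ((ball c r \<times> P) \<times> cbox 0 1) (\<lambda>y. I (fst y) (snd y))"
      unfolding I_def
      by (intro continuous_intros continuous_on_compose2[OF c\<gamma>]) auto
    then show "continuous_on ((ball c r \<times> P) \<times> cbox 0 1) (\<lambda>(x, t). I x t)"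
      by (simp add: case_prod_unfold)
  qed
  then have "continuous_on (ball c r \<times> P) (\<lambda>x. 1 / (2 * pi * \<i>) * integral {0..1} (I x))"
    by (auto intro!: continuous_intros)
  then show ?thesis
    by (rule continuous_on_eq) (auto simp: deriv_eq)
next
  case False
  then show ?thesis by (simp add: ball_empty)
qed

lemma continuous_on_slice:
  "continuous_on (W \<times> T) h \<Longrightarrow> x \<in> W \<Longrightarrow> continuous_on T (\<lambda>t. h (x, t))"
  by (rule continuous_on_compose2[of _ h]) (auto intro!: continuous_intros)

text \<open>Differentiation under the integral sign, done locally on a bidisc. Joint continuity of
  the two partial derivatives is recovered from that of the kernel by applying Cauchy's formula in
  each variable separately.\<close>

lemma integral_holo2:
  fixes K :: "complex \<times> complex \<Rightarrow> real \<Rightarrow> complex"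
  assumes U: "open U" and cont: "continuous_on (U \<times> {0..1}) (\<lambda>(x, t). K x t)"
    and hol: "\<And>t. t \<in> {0..1} \<Longrightarrow> holo2 (\<lambda>x. K x t) U"
  shows "holo2 (\<lambda>x. integral {0..1} (K x)) U"
  unfolding holo2_def
proof
  fix x0 assume x0: "x0 \<in> U"
  obtain x1 x2 where x0_eq: "x0 = (x1, x2)" by force
  obtain A1 A2 where A: "open A1" "open A2" "x1 \<in> A1" "x2 \<in> A2" "A1 \<times> A2 \<subseteq> U"
    using U x0 unfolding open_prod_def x0_eq by force
  \<comment> \<open>Closed discs inside \<open>U\<close> are taken because Cauchy's formula uses the
    boundary circles; the open product \<open>W\<close> is convex, as \<open>leibniz_rule\<close>
    demands.\<close>
  obtain r1 r2 where r: "r1 > 0" "cball x1 r1 \<subseteq> A1" "r2 > 0" "cball x2 r2 \<subseteq> A2"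
    using A by (meson open_contains_cball)
  define W where "W = ball x1 r1 \<times> ball x2 r2"
  have inU: "(w, v) \<in> U" if "w \<in> cball x1 r1" "v \<in> cball x2 r2" for w v
    using that r A by blast
  have W: "open W" "convex W" "x0 \<in> W" "W \<subseteq> U"
    using r inU by (auto simp: W_def x0_eq intro!: open_Times convex_Times)
  define a where "a x t = deriv (\<lambda>w. K (w, snd x) t) (fst x)" for x t
  define b where "b x t = deriv (\<lambda>v. K (fst x, v) t) (snd x)" for x t
  have "continuous_on (ball x1 r1 \<times> (ball x2 r2 \<times> {0..1})) (\<lambda>(w, p). deriv (\<lambda>w. K (w, fst p) (snd p)) w)"
  proof (rule continuous_on_deriv_param)
    show "continuous_on (cball x1 r1 \<times> ball x2 r2 \<times> {0..1}) (\<lambda>(w, p). K (w, fst p) (snd p))"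
      unfolding case_prod_unfold
      by (rule continuous_on_compose2[OF cont, of _ "\<lambda>y. ((fst y, fst (snd y)), snd (snd y))", simplified])
        (use inU in \<open>auto intro!: continuous_intros\<close>)
    show "(\<lambda>w. K (w, fst p) (snd p)) holomorphic_on ball x1 r1" if "p \<in> ball x2 r2 \<times> {0..1}" for p
      by (rule holo2_curve_holomorphic[OF hol]) (use that inU in auto)
  qed
  from continuous_on_compose2[OF this, of "W \<times> {0..1}" "\<lambda>y. (fst (fst y), snd (fst y), snd y)"]
  have ca: "continuous_on (W \<times> {0..1}) (\<lambda>y. a (fst y) (snd y))"
    by (force intro!: continuous_intros simp: a_def W_def)
  have "continuous_on (ball x2 r2 \<times> (ball x1 r1 \<times> {0..1})) (\<lambda>(w, p). deriv (\<lambda>w. K (fst p, w) (snd p)) w)"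
  proof (rule continuous_on_deriv_param)
    show "continuous_on (cball x2 r2 \<times> ball x1 r1 \<times> {0..1}) (\<lambda>(w, p). K (fst p, w) (snd p))"
      unfolding case_prod_unfold
      by (rule continuous_on_compose2[OF cont, of _ "\<lambda>y. ((fst (snd y), fst y), snd (snd y))", simplified])
        (use inU in \<open>auto intro!: continuous_intros\<close>)
    show "(\<lambda>w. K (fst p, w) (snd p)) holomorphic_on ball x2 r2" if "p \<in> ball x1 r1 \<times> {0..1}" for p
      by (rule holo2_curve_holomorphic[OF hol]) (use that inU in auto)
  qed
  from continuous_on_compose2[OF this, of "W \<times> {0..1}" "\<lambda>y. (snd (fst y), fst (fst y), snd y)"]
  have cb: "continuous_on (W \<times> {0..1}) (\<lambda>y. b (fst y) (snd y))"
    by (force intro!: continuous_intros simp: b_def W_def)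
  have deriv: "((\<lambda>x. K x t) has_derivative (\<lambda>w. a x t * fst w + b x t * snd w)) (at x)"
    if x: "x \<in> W" and t: "t \<in> {0..1}" for x t
  proof -
    obtain c d where cd: "((\<lambda>x. K x t) has_derivative (\<lambda>w. c * fst w + d * snd w)) (at (fst x, snd x))"
      using hol[OF t] x W unfolding holo2_def by (metis prod.collapse subsetD)
    have "((\<lambda>w. (w, snd x)) has_derivative (\<lambda>h. (h, 0))) (at (fst x))"
      by (auto intro!: derivative_eq_intros)
    from has_derivative_compose[OF this cd]
    have "((\<lambda>w. K (w, snd x) t) has_field_derivative c) (at (fst x))"
      by (simp add: has_field_derivative_def)
    then have "c = a x t" unfolding a_def by (simp add: DERIV_imp_deriv)
    have "((\<lambda>w. (fst x, w)) has_derivative (\<lambda>h. (0, h))) (at (snd x))"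
      by (auto intro!: derivative_eq_intros)
    from has_derivative_compose[OF this cd]
    have "((\<lambda>w. K (fst x, w) t) has_field_derivative d) (at (snd x))"
      by (simp add: has_field_derivative_def)
    then have "d = b x t" unfolding b_def by (simp add: DERIV_imp_deriv)
    with \<open>c = a x t\<close> cd show ?thesis by simp
  qed
  \<comment> \<open>\<open>leibniz_rule\<close> integrates the derivative as a bounded linear map.
    Evaluation at \<open>w\<close> commutes with that integral, which shows that the integrated
    derivative is again complex linear.\<close>
  define D where "D x t = (blinfun_mult_right (a x t) o\<^sub>L fst_blinfun) + (blinfun_mult_right (b x t) o\<^sub>L snd_blinfun)"
    for x t
  have D_apply: "blinfun_apply (D x t) = (\<lambda>w. a x t * fst w + b x t * snd w)" for x t
    by (auto simp: D_def blinfun.add_left)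
  have cD: "continuous_on (W \<times> cbox 0 1) (\<lambda>(x, t). D x t)"
    unfolding D_def case_prod_unfold using ca cb
    by (intro continuous_intros bounded_bilinear.continuous_on[OF bounded_bilinear_blinfun_compose]
        bounded_linear.continuous_on[OF bounded_linear_blinfun_mult_right]) auto
  have "((\<lambda>x. integral (cbox 0 1) (K x)) has_derivative integral (cbox 0 1) (D x0)) (at x0 within W)"
  proof (rule leibniz_rule[OF _ _ cD \<open>x0 \<in> W\<close> \<open>convex W\<close>])
    show "((\<lambda>x. K x t) has_derivative blinfun_apply (D x t)) (at x within W)"
      if "x \<in> W" "t \<in> cbox 0 1" for x t
      unfolding D_apply using that by (auto intro!: has_derivative_at_withinI[OF deriv] simp del: split_paired_All)
    show "K x integrable_on cbox 0 1" if "x \<in> W" for x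
      by (rule integrable_continuous, rule continuous_on_compose2[OF cont, of _ "\<lambda>t. (x, t)", simplified])
        (use W that in \<open>auto intro!: continuous_intros\<close>)
  qed
  moreover have "blinfun_apply (integral {0..1} (D x0))
      = (\<lambda>w. integral {0..1} (a x0) * fst w + integral {0..1} (b x0) * snd w)"
  proof
    fix w
    have "D x0 integrable_on {0..1}"
      using continuous_on_slice[OF cD \<open>x0 \<in> W\<close>] by (intro integrable_continuous_interval) simp
    moreover have "a x0 integrable_on {0..1}" "b x0 integrable_on {0..1}"
      using continuous_on_slice[OF ca \<open>x0 \<in> W\<close>] continuous_on_slice[OF cb \<open>x0 \<in> W\<close>]
      by (simp_all add: integrable_continuous_interval)
    ultimately show "blinfun_apply (integral {0..1} (D x0)) w
      = integral {0..1} (a x0) * fst w + integral {0..1} (b x0) * snd w"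
      by (simp add: blinfun_apply_integral D_apply integral_add integrable_on_mult_left)
  qed
  ultimately have "((\<lambda>x. integral {0..1} (K x)) has_derivative
      (\<lambda>w. integral {0..1} (a x0) * fst w + integral {0..1} (b x0) * snd w)) (at x0)"
    using W at_within_open[of x0 W] by simp
  then show "\<exists>a b. ((\<lambda>x. integral {0..1} (K x)) has_derivative (\<lambda>w. a * fst w + b * snd w)) (at x0)"
    by blast
qed

subsection \<open>Analytic discs with boundary in the two tubes\<close>

definition tube_pos :: "(complex \<times> complex) set" where
  "tube_pos = {z. Im (fst z) > 0 \<and> Im (snd z) > 0}"

definition tube_neg :: "(complex \<times> complex) set" where
  "tube_neg = {z. Im (fst z) < 0 \<and> Im (snd z) < 0}"

lemma open_tube_pos: "open tube_pos" and open_tube_neg: "open tube_neg"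
  unfolding tube_pos_def tube_neg_def by (auto intro!: open_Collect_conj open_Collect_less continuous_intros)

text \<open>No conjugate of \<open>c\<close> in the denominator: for real \<open>c\<close> between
  -1 and 1 this is the disc automorphism fixing 1 and -1, and for complex \<open>c\<close> it
  remains holomorphic in \<open>c\<close> as well as in \<open>s\<close>.\<close>

definition moebius :: "complex \<Rightarrow> complex \<Rightarrow> complex" where
  "moebius c s = (s + c) / (1 + c * s)"

lemma moebius_denom_nonzero: "norm c < 1 \<Longrightarrow> norm s \<le> 1 \<Longrightarrow> 1 + c * s \<noteq> (0::complex)"
proof
  assume c: "norm c < 1" "norm s \<le> 1" and "1 + c * s = 0"
  then have "norm (c * s) = 1" by (metis add_eq_0_iff norm_minus_cancel norm_one)
  moreover have "norm c * norm s \<le> norm c * 1" using c by (intro mult_left_mono) auto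
  ultimately show False using c by (simp add: norm_mult)
qed

text \<open>On the circle \<open>norm s = 1\<close> the term with \<open>Im c\<close> drops out, so
  for every \<open>c\<close> in the unit disc the sign is that of \<open>Im s\<close>. Hence the
  boundary semicircles of the discs stay in the tubes for complex \<open>c\<close> too.\<close>

lemma Im_moebius:
  "Im (moebius c s) = (Im s * (1 - (norm c)\<^sup>2) + Im c * (1 - (norm s)\<^sup>2)) / (norm (1 + c * s))\<^sup>2"
proof -
  have "Im (moebius c s) = Im ((s + c) * cnj (1 + c * s)) / (norm (1 + c * s))\<^sup>2"
    unfolding moebius_def by (simp only: Im_divide_numeral complex_div_cnj[of "s + c"])
      (metis Im_complex_of_real Im_divide_of_real complex_div_cnj of_real_power)
  also have "Im ((s + c) * cnj (1 + c * s)) = Im s * (1 - (norm c)\<^sup>2) + Im c * (1 - (norm s)\<^sup>2)"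
    unfolding cmod_power2 by (simp add: algebra_simps power2_eq_square)
  finally show ?thesis .
qed

lemma moebius_pm1: "norm c < 1 \<Longrightarrow> moebius c 1 = 1" "norm c < 1 \<Longrightarrow> moebius c (-1) = -1"
  using moebius_denom_nonzero[of c 1] moebius_denom_nonzero[of c "-1"]
  by (auto simp: moebius_def field_simps)

lemma moebius_0: "moebius 0 s = s" by (simp add: moebius_def)

definition disc :: "complex \<Rightarrow> complex \<Rightarrow> complex \<times> complex" where
  "disc c s = (moebius c s, moebius (- c) s)"

text \<open>The two components use \<open>c\<close> and \<open>- c\<close>, so the term with
  \<open>Im c\<close> occurs with both signs, and the term with \<open>Im s\<close> has to dominate
  its absolute value.\<close>

lemma disc_tubes_iff:
  assumes "norm c < 1" "norm s \<le> 1"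
  shows "disc c s \<in> tube_pos \<longleftrightarrow> \<bar>Im c\<bar> * (1 - (norm s)\<^sup>2) < Im s * (1 - (norm c)\<^sup>2)"
    and "disc c s \<in> tube_neg \<longleftrightarrow> \<bar>Im c\<bar> * (1 - (norm s)\<^sup>2) < - Im s * (1 - (norm c)\<^sup>2)"
proof -
  have pos: "(norm (1 + c * s))\<^sup>2 > 0" "(norm (1 + (- c) * s))\<^sup>2 > 0"
    using moebius_denom_nonzero[of c s] moebius_denom_nonzero[of "-c" s] assms by auto
  have "1 - (norm s)\<^sup>2 \<ge> 0" using assms by (simp add: power_le_one)
  then have abs: "\<bar>Im c\<bar> * (1 - (norm s)\<^sup>2) = \<bar>Im c * (1 - (norm s)\<^sup>2)\<bar>"
    by (simp add: abs_mult)
  show "disc c s \<in> tube_pos \<longleftrightarrow> \<bar>Im c\<bar> * (1 - (norm s)\<^sup>2) < Im s * (1 - (norm c)\<^sup>2)"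
    unfolding tube_pos_def disc_def mem_Collect_eq fst_conv snd_conv Im_moebius abs
      zero_less_divide_iff[of _ "(norm (1 + c * s))\<^sup>2"] zero_less_divide_iff[of _ "(norm (1 + (- c) * s))\<^sup>2"]
    using pos by (auto simp: abs_less_iff)
  show "disc c s \<in> tube_neg \<longleftrightarrow> \<bar>Im c\<bar> * (1 - (norm s)\<^sup>2) < - Im s * (1 - (norm c)\<^sup>2)"
    unfolding tube_neg_def disc_def mem_Collect_eq fst_conv snd_conv Im_moebius abs
      divide_less_0_iff[of _ "(norm (1 + c * s))\<^sup>2"] divide_less_0_iff[of _ "(norm (1 + (- c) * s))\<^sup>2"]
    using pos by (auto simp: abs_less_iff)
qed

lemma holomorphic_disc:
  assumes "holo2 f G"
  shows "open T \<Longrightarrow> (\<And>c. c \<in> T \<Longrightarrow> norm c < 1 \<and> disc c s \<in> G) \<Longrightarrow> norm s \<le> 1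
      \<Longrightarrow> (\<lambda>c. f (disc c s)) holomorphic_on T"
    and "open T \<Longrightarrow> (\<And>s. s \<in> T \<Longrightarrow> norm s \<le> 1 \<and> disc c s \<in> G) \<Longrightarrow> norm c < 1
      \<Longrightarrow> (\<lambda>s. f (disc c s)) holomorphic_on T"
  unfolding disc_def moebius_def using moebius_denom_nonzero moebius_denom_nonzero[of "- c" for c]
  by (intro holo2_curve_holomorphic[OF assms]; force intro!: holomorphic_intros)+

text \<open>\<open>F\<close> is the Cauchy integral of \<open>f\<close> along the boundary of the
  disc with parameter \<open>c\<close>, evaluated at \<open>s\<close>. For small \<open>c\<close>
  the whole closed disc lies in \<open>G\<close>, so \<open>F\<close> agrees with \<open>f\<close>;
  for fixed \<open>s\<close> the identity theorem in \<open>c\<close> carries this to every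
  parameter whose point lies in a tube.\<close>

lemma disc_extension:
  assumes f: "holo2 f G" and G: "open G" "tube_pos \<subseteq> G" "tube_neg \<subseteq> G"
    and diag: "\<And>x::real. \<bar>x\<bar> \<le> 1 \<Longrightarrow> (of_real x, of_real x) \<in> G"
  obtains F where "holo2 F (ball 0 1 \<times> ball 0 1)"
    "\<And>s c. norm s < 1 \<Longrightarrow> norm c < 1 \<Longrightarrow> disc c s \<in> tube_pos \<union> tube_neg \<Longrightarrow> F (s, c) = f (disc c s)"
proof -
  define \<gamma> where "\<gamma> = circlepath 0 1"
  define K where "K x t = 1 / (2 * pi * \<i>) * (f (disc (snd x) (\<gamma> t)) / (\<gamma> t - fst x)
      * (2 * pi * \<i> * exp (2 * pi * \<i> * t)))" for x t
  define F where "F x = integral {0..1} (K x)" for x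
  have \<gamma>: "norm (\<gamma> t) = 1" for t by (simp add: \<gamma>_def circlepath norm_mult)
  have c\<gamma>: "continuous_on A \<gamma>" for A unfolding \<gamma>_def circlepath by (intro continuous_intros)
  have \<gamma>_ne: "\<gamma> t - s \<noteq> 0" if "norm s < 1" for t s using \<gamma>[of t] that by auto
  \<comment> \<open>Nonreal boundary points land in a tube, and the points 1 and -1 land on the
    corners of the diagonal segment, so the integral makes sense for every \<open>c\<close>.\<close>
  have circle: "disc c s \<in> G" if "norm c < 1" "norm s = 1" for c s
  proof (cases "Im s = 0")
    case True
    then have "\<bar>Re s\<bar> = 1" using that by (simp add: cmod_def)
    with True have "s = 1 \<or> s = -1" by (simp add: complex_eq_iff) linarith
    then show ?thesis
      using moebius_pm1[of c] moebius_pm1[of "-c"] that diag[of 1] diag[of "-1"] by (auto simp: disc_def)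
  next
    case False
    have "(norm c)\<^sup>2 < 1" using that by (simp add: power_less_one_iff abs_square_less_1)
    define X where "X = Im s * (1 - (norm c)\<^sup>2)"
    have "disc c s \<in> tube_pos \<longleftrightarrow> 0 < X" "disc c s \<in> tube_neg \<longleftrightarrow> X < 0"
      using that disc_tubes_iff[of c s] by (simp_all add: X_def)
    moreover have "X \<noteq> 0" unfolding X_def using False \<open>(norm c)\<^sup>2 < 1\<close> by simp
    ultimately have "disc c s \<in> tube_pos \<or> disc c s \<in> tube_neg" by linarith
    then show ?thesis using G by blast
  qed
  have holF: "holo2 F (ball 0 1 \<times> ball 0 1)"
    unfolding F_def
  proof (rule integral_holo2)
    have "continuous_on ((ball 0 1 \<times> ball 0 1) \<times> {0..1}) (\<lambda>y. f (disc (snd (fst y)) (\<gamma> (snd y))))"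
    proof (rule continuous_on_compose2[OF holo2_imp_continuous_on[OF f]])
      show "continuous_on ((ball 0 1 \<times> ball 0 1) \<times> {0..1}) (\<lambda>y. disc (snd (fst y)) (\<gamma> (snd y)))"
        unfolding disc_def moebius_def using moebius_denom_nonzero moebius_denom_nonzero[of "- c" for c]
        by (intro continuous_intros continuous_on_compose2[OF c\<gamma>]) (auto simp: \<gamma>)
    qed (use circle \<gamma> in auto)
    then show "continuous_on ((ball 0 1 \<times> ball 0 1) \<times> {0..1}) (\<lambda>(x, t). K x t)"
      unfolding K_def case_prod_unfold
      by (intro continuous_intros continuous_on_compose2[OF c\<gamma>]) (use \<gamma>_ne in auto)
    fix t :: real
    have "holo2 (\<lambda>x. f (disc (snd x) (\<gamma> t))) (ball 0 1 \<times> ball 0 1)"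
      unfolding disc_def
    proof (rule holo2_pair_compose[OF f])
      show "holo2 (\<lambda>z. moebius (snd z) (\<gamma> t)) (ball 0 1 \<times> ball 0 1)"
        "holo2 (\<lambda>z. moebius (- snd z) (\<gamma> t)) (ball 0 1 \<times> ball 0 1)"
        unfolding moebius_def using moebius_denom_nonzero moebius_denom_nonzero[of "- c" for c]
        by (intro holo2_intros; force simp: \<gamma>)+
    qed (use circle \<gamma> in \<open>auto simp: disc_def\<close>)
    then show "holo2 (\<lambda>x. K x t) (ball 0 1 \<times> ball 0 1)"
      unfolding K_def by (intro holo2_intros) (use \<gamma>_ne in auto)
  qed (simp add: open_Times)
  have F_eq: "F (s, c) = f (disc c s)"
    if "norm s < 1" "norm c < 1" and inG: "\<And>w. norm w \<le> 1 \<Longrightarrow> disc c w \<in> G" for s c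
  proof -
    have "continuous_on (cball 0 1) (\<lambda>w. f (disc c w))"
      unfolding disc_def moebius_def
      using moebius_denom_nonzero[OF that(2)] moebius_denom_nonzero[of "- c"] that inG
      by (intro continuous_on_compose2[OF holo2_imp_continuous_on[OF f]] continuous_intros)
        (auto simp: disc_def moebius_def)
    moreover have "(\<lambda>w. f (disc c w)) holomorphic_on ball 0 1"
      using that by (intro holomorphic_disc(2)[OF f]) auto
    ultimately have "((\<lambda>u. f (disc c u) / (u - s)) has_contour_integral 2 * of_real pi * \<i> * f (disc c s)) (circlepath 0 1)"
      using that by (intro Cauchy_integral_circlepath) auto
    then have "((\<lambda>t. f (disc c (\<gamma> t)) / (\<gamma> t - s) * (2 * pi * \<i> * exp (2 * pi * \<i> * t)))
        has_integral 2 * of_real pi * \<i> * f (disc c s)) {0..1}"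
      by (simp add: has_contour_integral \<gamma>_def vector_derivative_circlepath)
    from has_integral_mult_right[OF this, of "1 / (2 * pi * \<i>)"]
    have "(K (s, c) has_integral f (disc c s)) {0..1}"
      by (simp add: K_def[abs_def] mult.assoc)
    then show ?thesis unfolding F_def by (rule integral_unique)
  qed
  obtain \<epsilon> where \<epsilon>: "\<epsilon> > 0" "\<epsilon> \<le> 1" "\<And>c w. norm c < \<epsilon> \<Longrightarrow> norm w \<le> 1 \<Longrightarrow> disc c w \<in> G"
  proof -
    \<comment> \<open>The compactness argument needs an open set of pairs, while the closed disc of
      \<open>w\<close> is not open. \<open>W0\<close> is an open set around
      \<open>{0} \<times> cball 0 1\<close> on which neither denominator vanishes.\<close>
    define W0 where "W0 = {x :: complex \<times> complex. norm (fst x * snd x) < 1}"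
    have "open W0"
      unfolding W0_def by (rule open_Collect_less) (auto intro!: continuous_intros)
    have ne: "1 + fst x * snd x \<noteq> 0" "1 + - fst x * snd x \<noteq> 0" if "x \<in> W0" for x
    proof -
      have n: "norm (fst x * snd x) < 1" using that by (simp only: W0_def mem_Collect_eq)
      show "1 + fst x * snd x \<noteq> 0"
        using moebius_denom_nonzero[OF n, of 1] by (simp only: mult_1_right norm_one order_refl simp_thms)
      show "1 + - fst x * snd x \<noteq> 0"
        using moebius_denom_nonzero[of "- fst x * snd x" 1] n
        by (simp only: mult_1_right norm_one order_refl simp_thms mult_minus_left norm_minus_cancel)
    qed
    have "continuous_on W0 (\<lambda>x. disc (fst x) (snd x))"
      unfolding disc_def moebius_def using ne by (intro continuous_intros) auto
    then have oW: "open (W0 \<inter> (\<lambda>x. disc (fst x) (snd x)) -` G)"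
      using \<open>open W0\<close> G(1) by (rule continuous_open_preimage)
    have "disc 0 w \<in> G" if "norm w \<le> 1" for w
    proof (cases "Im w = 0")
      case True
      then have "\<bar>Re w\<bar> \<le> 1" "of_real (Re w) = w"
        using that by (simp_all add: complex_eq_iff cmod_def)
      then show ?thesis using diag[of "Re w"] by (simp add: disc_def moebius_0)
    next
      case False
      then have "(w, w) \<in> tube_pos \<union> tube_neg" by (auto simp: tube_pos_def tube_neg_def)
      then show ?thesis using G by (auto simp: disc_def moebius_0)
    qed
    then have "(0, w) \<in> W0 \<inter> (\<lambda>x. disc (fst x) (snd x)) -` G" if "norm w \<le> 1" for w
      using that by (simp add: W0_def)
    then have sub: "{0} \<times> cball 0 1 \<subseteq> W0 \<inter> (\<lambda>x. disc (fst x) (snd x)) -` G"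
      by (intro subsetI) (elim SigmaE, simp only: singleton_iff mem_cball_0)
    have "\<exists>X. 0 \<in> X \<and> open X \<and> X \<times> cball 0 1 \<subseteq> W0 \<inter> (\<lambda>x. disc (fst x) (snd x)) -` G"
      by (rule Elementary_Topology.tube_lemma[OF compact_cball oW sub])
    then obtain X where X: "0 \<in> X" "open X" "X \<times> cball 0 1 \<subseteq> W0 \<inter> (\<lambda>x. disc (fst x) (snd x)) -` G"
      by (elim exE conjE) 
    obtain e where e: "e > 0" "ball 0 e \<subseteq> X" using X(1,2) openE by blast
    show ?thesis
    proof (rule that[of "min e 1"])
      show "disc c w \<in> G" if "norm c < min e 1" "norm w \<le> 1" for c w
      proof -
        have "c \<in> X" using that e(2) by (simp add: subset_iff)
        then have "(c, w) \<in> X \<times> cball 0 1" using that by simp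
        from subsetD[OF X(3) this] show ?thesis by simp
      qed
    qed (use e in auto)
  qed
  show ?thesis
  proof (rule that[OF holF])
    fix s c assume s: "norm s < 1" and c: "norm c < 1" and T: "disc c s \<in> tube_pos \<union> tube_neg"
    \<comment> \<open>For \<open>Im s \<noteq> 0\<close> these are the parameters for which
      \<open>disc c s\<close> lies in a tube, both tubes being merged by the absolute value of
      \<open>Im s\<close>. Shrinking \<open>c\<close> towards 0 does not increase the left side or
      decrease the right side, so the set is starlike and meets the small parameters settled by
      \<open>F_eq\<close>.\<close>
    define \<Sigma> where "\<Sigma> = ball 0 1 \<inter> {c. \<bar>Im c\<bar> * (1 - (norm s)\<^sup>2) < \<bar>Im s\<bar> * (1 - (norm c)\<^sup>2)}"
    have le1: "1 - (norm s)\<^sup>2 \<ge> 0" using s by (simp add: power_le_one)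
    have pos: "1 - (norm c)\<^sup>2 > 0" if "norm c < 1" for c :: complex
      using that by (simp add: abs_square_less_1)
    have "open \<Sigma>" unfolding \<Sigma>_def by (intro open_Int open_Collect_less continuous_intros open_ball)
    have star: "of_real t * c \<in> \<Sigma>" if "c \<in> \<Sigma>" "0 \<le> t" "t \<le> 1" for t c
    proof -
      have "\<bar>Im (of_real t * c)\<bar> \<le> \<bar>Im c\<bar>" "norm (of_real t * c) \<le> norm c"
        using that by (auto simp: abs_mult norm_mult mult_left_le_one_le)
      moreover from this have "(norm (of_real t * c))\<^sup>2 \<le> (norm c)\<^sup>2" by (simp add: power_mono)
      ultimately have "\<bar>Im (of_real t * c)\<bar> * (1 - (norm s)\<^sup>2) \<le> \<bar>Im c\<bar> * (1 - (norm s)\<^sup>2)"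
        "\<bar>Im s\<bar> * (1 - (norm c)\<^sup>2) \<le> \<bar>Im s\<bar> * (1 - (norm (of_real t * c))\<^sup>2)"
        using le1 by (auto intro!: mult_right_mono mult_left_mono)
      then show ?thesis
        using that \<open>norm (of_real t * c) \<le> norm c\<close> by (auto simp: \<Sigma>_def)
    qed
    have \<Sigma>_iff: "c \<in> \<Sigma> \<and> Im s \<noteq> 0 \<longleftrightarrow> disc c s \<in> tube_pos \<union> tube_neg" if "norm c < 1" for c
    proof -
      have abs: "\<bar>Im s\<bar> * (1 - (norm c)\<^sup>2) = \<bar>Im s * (1 - (norm c)\<^sup>2)\<bar>"
        using pos[OF that] by (simp add: abs_mult)
      have 1: "0 \<le> \<bar>Im c\<bar> * (1 - (norm s)\<^sup>2)" using le1 by simp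
      have 2: "Im s \<noteq> 0 \<longleftrightarrow> Im s * (1 - (norm c)\<^sup>2) \<noteq> 0" using pos[OF that] by simp
      have 3: "y < \<bar>x\<bar> \<and> P \<longleftrightarrow> y < x \<or> y < - x" if "0 \<le> y" "P \<longleftrightarrow> x \<noteq> 0" for x y :: real and P
        using that by auto
      show ?thesis
        unfolding Un_iff disc_tubes_iff[OF that less_imp_le[OF s]] \<Sigma>_def Int_iff mem_Collect_eq abs
        using that 3[OF 1 2] by simp
    qed
    have "Im s \<noteq> 0" "c \<in> \<Sigma>" using \<Sigma>_iff[OF c] T by blast+
    have "0 \<in> \<Sigma>" using \<open>Im s \<noteq> 0\<close> by (auto simp: \<Sigma>_def)
    have "starlike \<Sigma>"
      unfolding starlike_def
      using star \<open>0 \<in> \<Sigma>\<close> by (auto simp: closed_segment_def scaleR_conv_of_real intro!: bexI[of _ 0])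
    have inT: "disc c s \<in> tube_pos \<union> tube_neg" if "c \<in> \<Sigma>" for c
      using that \<Sigma>_iff[of c] \<open>Im s \<noteq> 0\<close> by (auto simp: \<Sigma>_def)
    have "F (s, c) = f (disc c s)"
    proof (rule analytic_continuation_open[of "\<Sigma> \<inter> ball 0 \<epsilon>" \<Sigma> "\<lambda>c. F (s, c)" "\<lambda>c. f (disc c s)"])
      show "(\<lambda>c. F (s, c)) holomorphic_on \<Sigma>"
        using s by (intro holo2_curve_holomorphic[OF holF] \<open>open \<Sigma>\<close>) (auto simp: \<Sigma>_def intro: holomorphic_intros)
      show "(\<lambda>c. f (disc c s)) holomorphic_on \<Sigma>"
        using inT G s by (intro holomorphic_disc(1)[OF f] \<open>open \<Sigma>\<close>) (auto simp: \<Sigma>_def)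
      show "F (s, c) = f (disc c s)" if "c \<in> \<Sigma> \<inter> ball 0 \<epsilon>" for c
        using that \<epsilon> s by (intro F_eq) (auto simp: \<Sigma>_def)
      show "\<Sigma> \<inter> ball 0 \<epsilon> \<noteq> {}" using \<open>0 \<in> \<Sigma>\<close> \<epsilon> by auto
    qed (use \<open>open \<Sigma>\<close> \<open>starlike \<Sigma>\<close> \<open>c \<in> \<Sigma>\<close> in \<open>auto intro: starlike_imp_connected\<close>)
    then show "F (s, c) = f (disc c s)" .
  qed
qed

section \<open>The Cayley transform and the inversion of the family of discs\<close>

definition cayley :: "complex \<Rightarrow> complex" where
  "cayley u = (1 + u) / (1 - u)"

lemma Re_cayley: "Re (cayley u) = (1 - (norm u)\<^sup>2) / (norm (1 - u))\<^sup>2"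
  and Im_cayley: "Im (cayley u) = 2 * Im u / (norm (1 - u))\<^sup>2"
  unfolding cayley_def Re_divide Im_divide cmod_power2
  by (simp_all add: power2_eq_square algebra_simps)

lemma cayley_inverse: "u \<noteq> 1 \<Longrightarrow> (cayley u - 1) / (cayley u + 1) = u" "u \<noteq> 1 \<Longrightarrow> cayley u + 1 \<noteq> 0"
  unfolding cayley_def by (auto simp: field_simps)

lemma cayley_nonzero: "u \<noteq> 1 \<Longrightarrow> u \<noteq> -1 \<Longrightarrow> cayley u \<noteq> 0"
  unfolding cayley_def by (auto simp: add_eq_0_iff)

lemma norm_cayley_inverse:
  assumes "Re k > 0" shows "norm ((k - 1) / (k + 1)) < 1"
proof -
  have "(norm (k - 1))\<^sup>2 < (norm (k + 1))\<^sup>2"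
    unfolding cmod_power2 using assms by (simp add: power2_eq_square algebra_simps)
  then have "norm (k - 1) < norm (k + 1)" by (rule power_less_imp_less_base) simp
  then show ?thesis by (simp add: norm_divide divide_less_eq)
qed

text \<open>In Cayley coordinates the Moebius formula is multiplication, as in the addition theorem
  of tanh: numerator and denominator share the factor 2 / ((l + 1) (k + 1)), which cancels.\<close>

lemma moebius_cayley_inverse:
  assumes "l + 1 \<noteq> 0" "k + 1 \<noteq> 0" "l * k + 1 \<noteq> 0"
  shows "moebius ((k - 1) / (k + 1)) ((l - 1) / (l + 1)) = (l * k - 1) / (l * k + 1)"
proof -
  have "(l - 1) / (l + 1) + (k - 1) / (k + 1) = 2 * (l * k - 1) / ((l + 1) * (k + 1))"
    using assms by (simp add: field_simps)
  moreover have "1 + (k - 1) / (k + 1) * ((l - 1) / (l + 1)) = 2 * (l * k + 1) / ((l + 1) * (k + 1))"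
    using assms by (simp add: divide_simps) (simp add: algebra_simps)
  moreover have "2 * a / d / (2 * b / d) = a / b" if "d \<noteq> 0" for a b d :: complex
    using that by simp
  ultimately show ?thesis
    unfolding moebius_def using assms by (simp only: no_zero_divisors not_False_eq_True)
qed

lemma Re_csqrt_pos: "z \<notin> \<real>\<^sub>\<le>\<^sub>0 \<Longrightarrow> Re (csqrt z) > 0"
proof (rule ccontr)
  assume z: "z \<notin> \<real>\<^sub>\<le>\<^sub>0" and "\<not> Re (csqrt z) > 0"
  then have "Re (csqrt z) = 0" using csqrt_principal[of z] by auto
  then have "(csqrt z)\<^sup>2 = of_real (- (Im (csqrt z))\<^sup>2)"
    by (simp add: complex_eq_iff power2_eq_square)
  then have "z = of_real (- (Im (csqrt z))\<^sup>2)" by (simp only: power2_csqrt)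
  then have "z \<in> \<real>\<^sub>\<le>\<^sub>0" by (metis nonpos_Reals_of_real_iff neg_le_0_iff_le zero_le_power2)
  with z show False by simp
qed

text \<open>If the components have Cayley transforms \<open>l * k\<close> and \<open>l / k\<close>,
  the quotient is the square of \<open>k\<close>. The principal root is the one in the right half
  plane, which corresponds to \<open>norm c < 1\<close>.\<close>

definition disc_kappa :: "complex \<times> complex \<Rightarrow> complex" where
  "disc_kappa z = csqrt (cayley (fst z) / cayley (snd z))"

definition disc_lambda :: "complex \<times> complex \<Rightarrow> complex" where
  "disc_lambda z = cayley (fst z) / disc_kappa z"

text \<open>The Cayley transform conjugates \<open>(s, c) \<mapsto> disc c s\<close> to \<open>(l, k) \<mapsto> (l * k, l / k)\<close> on a
  product of two right half planes, so it is inverted by a square root.\<close>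

definition disc_dom :: "(complex \<times> complex) set" where
  "disc_dom = {z. fst z \<noteq> 1 \<and> fst z \<noteq> -1 \<and> snd z \<noteq> 1 \<and> snd z \<noteq> -1 \<and>
     cayley (fst z) / cayley (snd z) \<notin> \<real>\<^sub>\<le>\<^sub>0 \<and> Re (disc_lambda z) > 0}"

definition disc_c :: "complex \<times> complex \<Rightarrow> complex" where
  "disc_c z = (disc_kappa z - 1) / (disc_kappa z + 1)"

definition disc_s :: "complex \<times> complex \<Rightarrow> complex" where
  "disc_s z = (disc_lambda z - 1) / (disc_lambda z + 1)"

lemma disc_dom_facts:
  assumes "z \<in> disc_dom"
  shows "Re (disc_kappa z) > 0" "Re (disc_lambda z) > 0" "disc_kappa z \<noteq> 0" "disc_lambda z + 1 \<noteq> 0" "disc_kappa z + 1 \<noteq> 0"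
    "disc_lambda z * disc_kappa z = cayley (fst z)" "disc_lambda z / disc_kappa z = cayley (snd z)"
proof -
  show k: "Re (disc_kappa z) > 0" using assms Re_csqrt_pos by (auto simp: disc_dom_def disc_kappa_def)
  show l: "Re (disc_lambda z) > 0" using assms by (simp add: disc_dom_def)
  show nz: "disc_kappa z \<noteq> 0" "disc_lambda z + 1 \<noteq> 0" "disc_kappa z + 1 \<noteq> 0" using k l by (auto simp: complex_eq_iff)
  then show "disc_lambda z * disc_kappa z = cayley (fst z)" by (simp add: disc_lambda_def)
  have "(disc_kappa z)\<^sup>2 = cayley (fst z) / cayley (snd z)" by (simp add: disc_kappa_def)
  moreover have "cayley (fst z) \<noteq> 0" "cayley (snd z) \<noteq> 0"
    using assms by (auto simp: disc_dom_def cayley_nonzero)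
  moreover have "disc_lambda z / disc_kappa z = cayley (fst z) / (disc_kappa z)\<^sup>2"
    by (simp add: disc_lambda_def power2_eq_square)
  ultimately show "disc_lambda z / disc_kappa z = cayley (snd z)" by simp
qed

lemma disc_dom_inverse:
  assumes "z \<in> disc_dom"
  shows "norm (disc_c z) < 1" "norm (disc_s z) < 1" "disc (disc_c z) (disc_s z) = z"
proof -
  note k = disc_dom_facts[OF assms]
  show "norm (disc_c z) < 1" "norm (disc_s z) < 1"
    unfolding disc_c_def disc_s_def using k norm_cayley_inverse by blast+
  have u: "fst z \<noteq> 1" "snd z \<noteq> 1" using assms by (auto simp: disc_dom_def)
  have fst_eq: "moebius (disc_c z) (disc_s z) = fst z"
    unfolding disc_c_def disc_s_def
    using moebius_cayley_inverse[of "disc_lambda z" "disc_kappa z"] k cayley_inverse[OF u(1)] by simp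
  \<comment> \<open>Replacing \<open>c\<close> by \<open>- c\<close> inverts its Cayley transform,
    so the second component is another instance of the same multiplication rule.\<close>
  have "inverse (disc_kappa z) - 1 = (1 - disc_kappa z) / disc_kappa z" and ik: "inverse (disc_kappa z) + 1 = (disc_kappa z + 1) / disc_kappa z"
    using k(3) by (simp_all add: field_simps)
  then have "- disc_c z = (inverse (disc_kappa z) - 1) / (inverse (disc_kappa z) + 1)"
    using k(3,5) by (simp add: disc_c_def minus_divide_left)
  moreover have "inverse (disc_kappa z) + 1 \<noteq> 0" unfolding ik using k(3,5) by simp
  ultimately have "moebius (- disc_c z) (disc_s z) = snd z"
    unfolding disc_s_def
    using moebius_cayley_inverse[of "disc_lambda z" "inverse (disc_kappa z)"] k(4,7) cayley_inverse[OF u(2)]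
    by (simp add: divide_inverse)
  with fst_eq show "disc (disc_c z) (disc_s z) = z" by (simp add: disc_def)
qed

lemma disc_dom_holo2:
  shows "open disc_dom" "holo2 disc_c disc_dom" "holo2 disc_s disc_dom"
proof -
  \<comment> \<open>\<open>D1\<close> avoids the poles and zeros of the Cayley transforms,
    \<open>D2\<close> also the branch cut of the square root; positivity of
    \<open>Re (disc_lambda z)\<close> is then an open condition on \<open>D2\<close>.\<close>
  define D1 where "D1 = {z :: complex \<times> complex. fst z \<noteq> 1 \<and> fst z \<noteq> -1 \<and> snd z \<noteq> 1 \<and> snd z \<noteq> -1}"
  define q where "q z = cayley (fst z) / cayley (snd z)" for z
  define D2 where "D2 = D1 \<inter> q -` (- \<real>\<^sub>\<le>\<^sub>0)"
  have "open D1" unfolding D1_def by (intro open_Collect_conj open_Collect_neq continuous_intros)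
  have c1: "holo2 (\<lambda>z. cayley (fst z)) D1" "holo2 (\<lambda>z. cayley (snd z)) D1"
    unfolding cayley_def by (intro holo2_intros; simp add: D1_def)+
  then have q: "holo2 q D1"
    unfolding q_def by (intro holo2_divide) (auto simp: D1_def cayley_nonzero)
  then have "open D2"
    unfolding D2_def by (intro continuous_open_preimage holo2_imp_continuous_on \<open>open D1\<close>) (auto simp: closed_def[symmetric])
  have "D2 \<subseteq> D1" by (auto simp: D2_def)
  have disc_kappa: "holo2 disc_kappa D2"
    unfolding disc_kappa_def q_def[symmetric] using holo2_subset[OF q \<open>D2 \<subseteq> D1\<close>]
    by (rule holo2_compose_field) (auto simp: D2_def intro!: field_differentiable_at_csqrt)
  have "disc_kappa z \<noteq> 0" if "z \<in> D2" for z
    using that Re_csqrt_pos[of "q z"] by (auto simp: D2_def disc_kappa_def q_def)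
  then have disc_lambda: "holo2 disc_lambda D2"
    unfolding disc_lambda_def using disc_kappa holo2_subset[OF c1(1) \<open>D2 \<subseteq> D1\<close>] by (intro holo2_divide)
  have eq: "disc_dom = D2 \<inter> disc_lambda -` {w. Re w > 0}" by (auto simp: disc_dom_def D2_def D1_def q_def)
  show "open disc_dom"
    unfolding eq by (intro continuous_open_preimage holo2_imp_continuous_on disc_lambda \<open>open D2\<close>) (rule open_halfspace_Re_gt)
  have sub: "disc_dom \<subseteq> D2" by (auto simp: eq)
  show "holo2 disc_c disc_dom" "holo2 disc_s disc_dom"
    unfolding disc_c_def disc_s_def using disc_dom_facts
    by (intro holo2_intros holo2_subset[OF disc_kappa sub] holo2_subset[OF disc_lambda sub]; simp)+
qed

section \<open>Extension across the square with corners (-1, -1) and (1, 1)\<close>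

text \<open>Away from the poles, the Cayley transforms U, V of the components turn the inequality
  into |Im U| Re V + |Im V| Re U > 0, the condition of a quadrant with corner 0. The bidisc adds the
  real points, where the inequality degenerates to 0 > 0.\<close>

definition unit_patch :: "(complex \<times> complex) set" where
  "unit_patch = tube_pos \<union> tube_neg \<union>
     {z. \<bar>Im (fst z)\<bar> * (1 - (norm (snd z))\<^sup>2) + \<bar>Im (snd z)\<bar> * (1 - (norm (fst z))\<^sup>2) > 0} \<union>
     {z. norm (fst z) < 1 \<and> norm (snd z) < 1}"

text \<open>\<open>2 * Re l * Im k\<close> is \<open>Im (l * k) - Im (l * cnj k)\<close>, and
  \<open>Im (l / k)\<close> is a positive multiple of the last term, so the sign conditions give
  \<open>Re l \<ge> 0\<close>. For \<open>Re l = 0\<close> both terms equal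
  \<open>Im l * Re k\<close>, which forces \<open>l = 0\<close>.\<close>

lemma Re_pos_of_signs:
  assumes k: "Re k > 0" and M: "Im (l * k) * Im k \<ge> 0" and N: "Im (l / k) * Im k \<le> 0"
    and "Im k \<noteq> 0" "l \<noteq> 0"
  shows "Re l > 0"
proof -
  have eqN: "Im (l / k) = Im (l * cnj k) / (norm k)\<^sup>2"
    unfolding Im_divide cmod_power2 by (simp add: algebra_simps)
  have "norm k > 0" using k by auto
  then have N': "Im (l * cnj k) * Im k \<le> 0"
    using N unfolding eqN by (simp add: divide_le_0_iff)
  have "2 * (Re l * (Im k)\<^sup>2) = Im (l * k) * Im k - Im (l * cnj k) * Im k"
    by (simp add: power2_eq_square algebra_simps)
  then have "Re l * (Im k)\<^sup>2 \<ge> 0" using M N' by linarith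
  then have "Re l \<ge> 0" using \<open>Im k \<noteq> 0\<close> by (simp add: zero_le_mult_iff)
  moreover have "Re l \<noteq> 0"
  proof
    assume "Re l = 0"
    then have "Im l * Re k * Im k = 0" using M N' by (simp add: algebra_simps) 
    then have "Im l = 0" using k \<open>Im k \<noteq> 0\<close> by simp
    with \<open>Re l = 0\<close> \<open>l \<noteq> 0\<close> show False by (simp add: complex_eq_iff)
  qed
  ultimately show ?thesis by simp
qed

text \<open>Outside the tubes \<open>Im u\<close> and \<open>Im v\<close> have weakly opposite
  signs, so the sum of absolute values is, up to sign, a positive multiple of the imaginary part of
  the quotient \<open>q\<close> of the Cayley transforms. Hence \<open>q\<close> avoids the branch
  cut, and the known signs feed \<open>Re_pos_of_signs\<close>.\<close>

lemma unit_patch_subset: "unit_patch \<subseteq> tube_pos \<union> tube_neg \<union> disc_dom"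
proof
  fix z assume z: "z \<in> unit_patch"
  define u v where "u = fst z" and "v = snd z"
  have uv: "z = (u, v)" by (simp add: u_def v_def)
  define X Y where "X = 1 - (norm u)\<^sup>2" and "Y = 1 - (norm v)\<^sup>2"
  show "z \<in> tube_pos \<union> tube_neg \<union> disc_dom"
  proof (rule ccontr)
    assume not: "z \<notin> tube_pos \<union> tube_neg \<union> disc_dom"
    have sgn: "Im u \<ge> 0 \<and> Im v \<le> 0 \<or> Im u \<le> 0 \<and> Im v \<ge> 0"
      using not by (auto simp: tube_pos_def tube_neg_def uv)
    have sq: "norm w < 1 \<longleftrightarrow> (norm w)\<^sup>2 < 1" for w :: complex by (simp add: abs_square_less_1)
    \<comment> \<open>A bidisc point with a nonreal component satisfies the strict inequality
      already, so the bidisc leaves only real points as a separate case.\<close>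
    have "\<bar>Im u\<bar> * Y + \<bar>Im v\<bar> * X > 0 \<or> (Im u = 0 \<and> Im v = 0 \<and> X > 0 \<and> Y > 0)"
    proof (cases "norm u < 1 \<and> norm v < 1")
      case True
      then have "X > 0" "Y > 0" by (simp_all add: X_def Y_def sq)
      then show ?thesis
        by (cases "Im u = 0"; cases "Im v = 0") (auto intro: add_nonneg_pos add_pos_nonneg)
    next
      case False
      then show ?thesis using z not by (auto simp: unit_patch_def X_def Y_def uv)
    qed
    then consider (pos) "\<bar>Im u\<bar> * Y + \<bar>Im v\<bar> * X > 0" | (real) "Im u = 0" "Im v = 0" "X > 0" "Y > 0"
      by blast
    then have ne: "u \<noteq> 1 \<and> u \<noteq> -1 \<and> v \<noteq> 1 \<and> v \<noteq> -1"
      by cases (auto simp: X_def Y_def)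
    then have nz: "cayley u \<noteq> 0" "cayley v \<noteq> 0" using cayley_nonzero by blast+
    have d: "(norm (1 - u))\<^sup>2 > 0" "(norm (1 - v))\<^sup>2 > 0" using ne by auto
    define q where "q = cayley u / cayley v"
    have k2: "(disc_kappa z)\<^sup>2 = q" by (simp add: disc_kappa_def q_def uv)
    have "q \<notin> \<real>\<^sub>\<le>\<^sub>0 \<and> Re (disc_lambda z) > 0"
      using \<open>\<bar>Im u\<bar> * Y + \<bar>Im v\<bar> * X > 0 \<or> _\<close>
    proof
      assume pos: "\<bar>Im u\<bar> * Y + \<bar>Im v\<bar> * X > 0"
      have "Im q = (Im (cayley u) * Re (cayley v) - Re (cayley u) * Im (cayley v)) / (norm (cayley v))\<^sup>2"
        unfolding q_def Im_divide cmod_power2 by simp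
      also have "\<dots> = 2 * (Im u * Y - Im v * X) / ((norm (1 - u))\<^sup>2 * (norm (1 - v))\<^sup>2 * (norm (cayley v))\<^sup>2)"
      proof -
        have "2 * p / d1 * (y / d2) - x / d1 * (2 * q / d2) = 2 * (p * y - q * x) / (d1 * d2)"
          for p q x y d1 d2 :: real by (simp add: diff_divide_distrib algebra_simps)
        then show ?thesis unfolding Re_cayley Im_cayley X_def Y_def by simp
      qed
      finally have Imq: "Im q = 2 * (Im u * Y - Im v * X) / ((norm (1 - u))\<^sup>2 * (norm (1 - v))\<^sup>2 * (norm (cayley v))\<^sup>2)" .
      have den: "(norm (1 - u))\<^sup>2 * (norm (1 - v))\<^sup>2 * (norm (cayley v))\<^sup>2 > 0" using d nz by simp
      have q0: "Im q \<noteq> 0" and qs: "Im u \<ge> 0 \<and> Im v \<le> 0 \<and> Im q > 0 \<or> Im u \<le> 0 \<and> Im v \<ge> 0 \<and> Im q < 0"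
        using sgn pos den unfolding Imq zero_less_divide_iff divide_less_0_iff divide_eq_0_iff
        by (auto simp: abs_if split: if_splits)
      then have nq: "q \<notin> \<real>\<^sub>\<le>\<^sub>0" by (auto simp: complex_nonpos_Reals_iff)
      then have k: "Re (disc_kappa z) > 0" using Re_csqrt_pos by (simp add: disc_kappa_def q_def uv)
      then have kz: "disc_kappa z \<noteq> 0" by auto
      have "Im q = 2 * Re (disc_kappa z) * Im (disc_kappa z)" unfolding k2[symmetric] by (simp add: power2_eq_square)
      \<comment> \<open>Squaring a number of positive real part preserves the sign of its imaginary
        part.\<close>
      then have ks: "Im (disc_kappa z) > 0 \<longleftrightarrow> Im q > 0" "Im (disc_kappa z) < 0 \<longleftrightarrow> Im q < 0"
        using k by (auto simp: zero_less_mult_iff mult_less_0_iff)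
      have lk: "disc_lambda z * disc_kappa z = cayley u" using kz by (simp add: disc_lambda_def uv)
      have lk': "disc_lambda z / disc_kappa z = cayley v"
        using k2 kz nz by (simp add: disc_lambda_def uv q_def power2_eq_square field_simps)
      have "disc_lambda z \<noteq> 0" using lk nz by auto
      have "Re (disc_lambda z) > 0"
      proof (rule Re_pos_of_signs[OF k])
        show "Im (disc_kappa z) \<noteq> 0" using ks q0 by auto
        show "Im (disc_lambda z * disc_kappa z) * Im (disc_kappa z) \<ge> 0" "Im (disc_lambda z / disc_kappa z) * Im (disc_kappa z) \<le> 0"
          unfolding lk lk' Im_cayley using qs ks d
          by (auto simp: zero_le_mult_iff mult_le_0_iff zero_le_divide_iff divide_le_0_iff)
      qed fact
      with nq show ?thesis by blast
    next
      \<comment> \<open>Over the real square both Cayley transforms are positive reals, and so are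
        their quotient, its root and \<open>disc_lambda z\<close>.\<close>
      assume re: "Im u = 0 \<and> Im v = 0 \<and> X > 0 \<and> Y > 0"
      define m n where "m = Re (cayley u)" and "n = Re (cayley v)"
      have "cayley u = of_real m" "cayley v = of_real n"
        using re by (auto simp: complex_eq_iff Im_cayley m_def n_def)
      moreover have "m > 0" "n > 0"
        using re d by (auto simp: m_def n_def Re_cayley X_def Y_def)
      ultimately have "q = of_real (m / n)" "m / n > 0" "disc_lambda z = of_real (m / sqrt (m / n))"
        by (auto simp: q_def disc_lambda_def disc_kappa_def uv simp flip: of_real_divide of_real_sqrt)
      then show ?thesis using \<open>m > 0\<close> by (simp del: of_real_divide)
    qed
    then show False using ne not by (simp add: disc_dom_def uv q_def)
  qed
qed

text \<open>The definition by cases is consistent: where \<open>disc_dom\<close> meets a tube,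
  \<open>F0\<close> composed with the inverse of the disc map equals \<open>f\<close>. So
  \<open>F\<close> is given by one holomorphic formula on each of two open sets.\<close>

lemma unit_patch_extension:
  assumes f: "holo2 f G" and G: "open G" "tube_pos \<subseteq> G" "tube_neg \<subseteq> G"
    and diag: "\<And>x::real. \<bar>x\<bar> \<le> 1 \<Longrightarrow> (of_real x, of_real x) \<in> G"
  obtains F where "holo2 F unit_patch" "\<And>z. z \<in> tube_pos \<union> tube_neg \<Longrightarrow> F z = f z"
proof -
  obtain F0 where F0: "holo2 F0 (ball 0 1 \<times> ball 0 1)"
    "\<And>s c. norm s < 1 \<Longrightarrow> norm c < 1 \<Longrightarrow> disc c s \<in> tube_pos \<union> tube_neg \<Longrightarrow> F0 (s, c) = f (disc c s)"
    using disc_extension[OF assms] by blast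
  define F where "F z = (if z \<in> tube_pos \<union> tube_neg then f z else F0 (disc_s z, disc_c z))" for z
  have "holo2 F (tube_pos \<union> tube_neg)"
  proof (rule holo2_transform)
    show "holo2 f (tube_pos \<union> tube_neg)" by (rule holo2_subset[OF f]) (use G in blast)
    show "open (tube_pos \<union> tube_neg)" using open_tube_pos open_tube_neg by blast
  qed (simp add: F_def)
  moreover have "holo2 F disc_dom"
  proof (rule holo2_transform)
    show "holo2 (\<lambda>z. F0 (disc_s z, disc_c z)) disc_dom"
      using disc_dom_inverse by (intro holo2_pair_compose[OF F0(1)] disc_dom_holo2) auto
    show "F0 (disc_s z, disc_c z) = F z" if "z \<in> disc_dom" for z
      using disc_dom_inverse[OF that] F0(2)[of "disc_s z" "disc_c z"] by (auto simp: F_def)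
  qed (rule disc_dom_holo2)
  ultimately have "holo2 F (tube_pos \<union> tube_neg \<union> disc_dom)" unfolding holo2_def by blast
  then have "holo2 F unit_patch" using unit_patch_subset by (rule holo2_subset)
  then show ?thesis by (rule that) (simp add: F_def)
qed

section \<open>Rescaling to squares with lower corner \<open>(\<alpha>, \<beta>)\<close>\<close>

text \<open>The image of \<open>unit_patch\<close> under u -> \<alpha> + R + R u, v -> \<beta> + R +
  R v. The bracket 2 R (Re u - \<alpha>) - |u - \<alpha>|^2 is R^2 - |u - (\<alpha> + R)|^2; in this
  form the corner stays fixed as R grows.\<close>

definition patch :: "real \<Rightarrow> real \<Rightarrow> real \<Rightarrow> (complex \<times> complex) set" where
  "patch \<alpha> \<beta> R = tube_pos \<union> tube_neg \<union>
     {z. \<bar>Im (fst z)\<bar> * (2 * R * (Re (snd z) - \<beta>) - (norm (snd z - of_real \<beta>))\<^sup>2)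
       + \<bar>Im (snd z)\<bar> * (2 * R * (Re (fst z) - \<alpha>) - (norm (fst z - of_real \<alpha>))\<^sup>2) > 0} \<union>
     {z. (norm (fst z - of_real \<alpha>))\<^sup>2 < 2 * R * (Re (fst z) - \<alpha>) \<and>
         (norm (snd z - of_real \<beta>))\<^sup>2 < 2 * R * (Re (snd z) - \<beta>)}"

lemma patch_affine_iff:
  assumes R: "R > 0"
  shows "(of_real (\<alpha> + R) + of_real R * u, of_real (\<beta> + R) + of_real R * v) \<in> patch \<alpha> \<beta> R
    \<longleftrightarrow> (u, v) \<in> unit_patch"
proof -
  have key: "2 * R * (R + R * Re w) - (norm (of_real R + of_real R * w))\<^sup>2 = R\<^sup>2 * (1 - (norm w)\<^sup>2)" for w
    unfolding cmod_power2 by (simp add: power2_eq_square algebra_simps)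
  have lt: "(norm (of_real R + of_real R * w))\<^sup>2 < 2 * R * (R + R * Re w) \<longleftrightarrow> norm w < 1" for w
  proof -
    have "(norm (of_real R + of_real R * w))\<^sup>2 < 2 * R * (R + R * Re w) \<longleftrightarrow> 0 < R\<^sup>2 * (1 - (norm w)\<^sup>2)"
      unfolding key[symmetric] by linarith
    then show ?thesis using R by (simp add: zero_less_mult_iff abs_square_less_1)
  qed
  have sum: "\<bar>R * Im u\<bar> * (R\<^sup>2 * (1 - (norm v)\<^sup>2)) + \<bar>R * Im v\<bar> * (R\<^sup>2 * (1 - (norm u)\<^sup>2))
    = (R * R\<^sup>2) * (\<bar>Im u\<bar> * (1 - (norm v)\<^sup>2) + \<bar>Im v\<bar> * (1 - (norm u)\<^sup>2))"
    using R by (simp add: abs_mult algebra_simps)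
  have "R * R\<^sup>2 > 0" using R by simp
  then show ?thesis
    unfolding patch_def unit_patch_def tube_pos_def tube_neg_def
    using R by (simp add: key lt sum zero_less_mult_iff mult_less_0_iff) 
qed

lemma patch_extension:
  assumes R: "R > 0" and f: "holo2 f G" and G: "open G" "tube_pos \<subseteq> G" "tube_neg \<subseteq> G"
    and diag: "\<And>x::real. 0 \<le> x \<Longrightarrow> (of_real (\<alpha> + x), of_real (\<beta> + x)) \<in> G"
  obtains F where "holo2 F (patch \<alpha> \<beta> R)" "\<And>z. z \<in> tube_pos \<union> tube_neg \<Longrightarrow> F z = f z"
proof -
  define a b where "a u = of_real (\<alpha> + R) + of_real R * u" and "b v = of_real (\<beta> + R) + of_real R * v" for u v :: complex
  define a' b' where "a' u = (u - of_real (\<alpha> + R)) / of_real R" and "b' v = (v - of_real (\<beta> + R)) / of_real R" for u v :: complex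
  define G' where "G' = (\<lambda>z. (a (fst z), b (snd z))) -` G"
  have inv: "a (a' u) = u" "b (b' v) = v" for u v
    using R by (auto simp: a_def b_def a'_def b'_def)
  have "open G'"
    unfolding G'_def a_def b_def using G(1) by (intro open_vimage continuous_intros)
  have fG': "holo2 (\<lambda>z. f (a (fst z), b (snd z))) G'"
    by (rule holo2_pair_compose[OF f]) (auto simp: a_def b_def G'_def intro!: holo2_intros)
  have T: "(a u, b v) \<in> tube_pos \<longleftrightarrow> (u, v) \<in> tube_pos" "(a u, b v) \<in> tube_neg \<longleftrightarrow> (u, v) \<in> tube_neg" for u v
    using R by (auto simp: tube_pos_def tube_neg_def a_def b_def zero_less_mult_iff mult_less_0_iff)
  have "(a (fst z), b (snd z)) \<in> G" if "z \<in> tube_pos \<union> tube_neg" for z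
    using that T[of "fst z" "snd z"] G(2,3) by auto
  then have "tube_pos \<subseteq> G'" "tube_neg \<subseteq> G'" by (auto simp: G'_def)
  moreover have "(of_real x, of_real x) \<in> G'" if "\<bar>x\<bar> \<le> 1" for x :: real
  proof -
    have "0 \<le> R * (1 + x)" using R that by simp
    from diag[OF this] show ?thesis by (simp add: G'_def a_def b_def algebra_simps)
  qed
  ultimately obtain F where F: "holo2 F unit_patch" "\<And>z. z \<in> tube_pos \<union> tube_neg \<Longrightarrow> F z = f (a (fst z), b (snd z))"
    using unit_patch_extension[OF fG' \<open>open G'\<close>] by metis
  have iff: "(u, v) \<in> patch \<alpha> \<beta> R \<longleftrightarrow> (a' u, b' v) \<in> unit_patch" for u v
    using patch_affine_iff[OF R, of \<alpha> "a' u" \<beta> "b' v"] inv by (simp add: a_def b_def)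
  have "holo2 (\<lambda>z. F (a' (fst z), b' (snd z))) (patch \<alpha> \<beta> R)"
    using R by (intro holo2_pair_compose[OF F(1)]) (auto simp: a'_def b'_def iff[unfolded a'_def b'_def] intro!: holo2_intros)
  moreover have "F (a' (fst z), b' (snd z)) = f z" if "z \<in> tube_pos \<union> tube_neg" for z
    using that T[of "a' (fst z)" "b' (snd z)"] F(2)[of "(a' (fst z), b' (snd z))"] by (simp add: inv)
  ultimately show ?thesis by (rule that)
qed

subsection \<open>Gluing the local extensions\<close>

text \<open>All functions agree on \<open>T\<close>, which lies in every \<open>U i\<close>, so the
  identity theorem on the connected pairwise intersections makes the value of \<open>H\<close>
  independent of the index chosen by \<open>SOME\<close>.\<close>

lemma holo2_glue:
  assumes U: "\<And>i. i \<in> I \<Longrightarrow> open (U i)" "\<And>i j. i \<in> I \<Longrightarrow> j \<in> I \<Longrightarrow> connected (U i \<inter> U j)"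
    and F: "\<And>i. i \<in> I \<Longrightarrow> holo2 (F i) (U i)"
    and T: "open T" "T \<noteq> {}" "\<And>i. i \<in> I \<Longrightarrow> T \<subseteq> U i" "\<And>i z. i \<in> I \<Longrightarrow> z \<in> T \<Longrightarrow> F i z = f z"
  obtains H where "holo2 H (\<Union>i\<in>I. U i)" "\<And>i z. i \<in> I \<Longrightarrow> z \<in> U i \<Longrightarrow> H z = F i z"
proof -
  define H where "H z = F (SOME i. i \<in> I \<and> z \<in> U i) z" for z
  have H: "H z = F i z" if i: "i \<in> I" and z: "z \<in> U i" for i z
  proof -
    define j where "j = (SOME i. i \<in> I \<and> z \<in> U i)"
    have j: "j \<in> I" "z \<in> U j"
      using someI[of "\<lambda>i. i \<in> I \<and> z \<in> U i" i] i z unfolding j_def by blast+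
    have "F j z = F i z"
    proof (rule holo2_identity[of "U i \<inter> U j" T])
      show "holo2 (F j) (U i \<inter> U j)" "holo2 (F i) (U i \<inter> U j)"
        using F i j by (auto intro: holo2_subset)
    qed (use i j z U T in auto)
    then show ?thesis by (simp add: H_def j_def)
  qed
  have "holo2 H (U i)" if "i \<in> I" for i
    by (rule holo2_transform[OF F[OF that] U(1)[OF that]]) (simp add: H[OF that])
  then have "holo2 H (\<Union>i\<in>I. U i)" unfolding holo2_def by blast
  then show ?thesis using H by (rule that)
qed

lemma open_patch: "open (patch \<alpha> \<beta> R)"
  unfolding patch_def
  by (intro open_Un open_tube_pos open_tube_neg open_Collect_conj open_Collect_less continuous_intros)

text \<open>Starlike about the origin: a factor \<open>t\<close> in (0, 1] scales both imaginary
  parts by \<open>t\<close> and does not decrease the terms 1 - |u|^2 and 1 - |v|^2.\<close>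

lemma connected_unit_patch: "connected unit_patch"
proof (rule starlike_imp_connected)
  have 0: "(0, 0) \<in> unit_patch" by (simp add: unit_patch_def)
  have "t *\<^sub>R z \<in> unit_patch" if z: "z \<in> unit_patch" and t: "0 \<le> t" "t \<le> 1" for z and t :: real
  proof (cases "t = 0")
    case True
    then show ?thesis using 0 by (simp add: zero_prod_def)
  next
    case False
    define u v where "u = fst z" and "v = snd z"
    have le: "norm (t *\<^sub>R w) \<le> norm w" for w :: complex using t by (simp add: mult_left_le_one_le)
    have "\<bar>Im u\<bar> * (1 - (norm v)\<^sup>2) + \<bar>Im v\<bar> * (1 - (norm u)\<^sup>2)
        \<le> \<bar>Im u\<bar> * (1 - (norm (t *\<^sub>R v))\<^sup>2) + \<bar>Im v\<bar> * (1 - (norm (t *\<^sub>R u))\<^sup>2)"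
      using le by (intro add_mono mult_left_mono diff_left_mono power_mono) auto
    moreover have "\<bar>Im (t *\<^sub>R u)\<bar> * (1 - (norm (t *\<^sub>R v))\<^sup>2) + \<bar>Im (t *\<^sub>R v)\<bar> * (1 - (norm (t *\<^sub>R u))\<^sup>2)
      = t * (\<bar>Im u\<bar> * (1 - (norm (t *\<^sub>R v))\<^sup>2) + \<bar>Im v\<bar> * (1 - (norm (t *\<^sub>R u))\<^sup>2))"
      using t by (simp add: abs_mult algebra_simps)
    ultimately show ?thesis
      using z t False le_less_trans[OF le, of u 1] le_less_trans[OF le, of v 1]
      unfolding unit_patch_def tube_pos_def tube_neg_def u_def v_def
      by (auto simp: zero_less_mult_iff mult_less_0_iff)
  qed
  then show "starlike unit_patch"
    unfolding starlike_def using 0 by (intro bexI[of _ "(0, 0)"]) (auto simp: closed_segment_def)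
qed

lemma connected_patch:
  assumes "R > 0" shows "connected (patch \<alpha> \<beta> R)"
proof -
  define A where "A z = (of_real (\<alpha> + R) + of_real R * fst z, of_real (\<beta> + R) + of_real R * snd z)"
    for z :: "complex \<times> complex"
  have "patch \<alpha> \<beta> R = A ` unit_patch"
  proof (intro equalityI subsetI)
    fix z assume z: "z \<in> patch \<alpha> \<beta> R"
    define w where "w = ((fst z - of_real (\<alpha> + R)) / of_real R, (snd z - of_real (\<beta> + R)) / of_real R)"
    have "A w = z" using assms by (simp add: A_def w_def)
    then show "z \<in> A ` unit_patch"
      using z patch_affine_iff[OF assms, of \<alpha> "fst w" \<beta> "snd w"] by (auto simp: A_def intro!: image_eqI[of _ _ w])
  next
    fix z assume "z \<in> A ` unit_patch"
    then show "z \<in> patch \<alpha> \<beta> R" using patch_affine_iff[OF assms] by (auto simp: A_def)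
  qed
  moreover have "continuous_on unit_patch A" unfolding A_def by (intro continuous_intros)
  ultimately show ?thesis using connected_continuous_image connected_unit_patch by metis
qed

text \<open>The left side of the inequality is 2 R (p b + q a) minus a nonnegative term free of R.
  Positivity forces p b + q a > 0, so a larger R preserves it. The patches thus form a chain, and
  their intersections are connected.\<close>

lemma patch_mono:
  assumes "0 < R" "R \<le> R'" shows "patch \<alpha> \<beta> R \<subseteq> patch \<alpha> \<beta> R'"
proof
  fix z assume z: "z \<in> patch \<alpha> \<beta> R"
  define a b p q m n where "a = Re (fst z) - \<alpha>" and "b = Re (snd z) - \<beta>" and "p = \<bar>Im (fst z)\<bar>"
    and "q = \<bar>Im (snd z)\<bar>" and "m = (norm (fst z - of_real \<alpha>))\<^sup>2" and "n = (norm (snd z - of_real \<beta>))\<^sup>2"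
  note defs = a_def b_def p_def q_def m_def n_def
  have nn: "p \<ge> 0" "q \<ge> 0" "m \<ge> 0" "n \<ge> 0" by (simp_all add: defs)
  have mono: "2 * R * x \<le> 2 * R' * x" if "x \<ge> 0" for x
    using assms that by (simp add: mult_right_mono)
  have "p * (2 * R' * b - n) + q * (2 * R' * a - m) > 0" if g: "p * (2 * R * b - n) + q * (2 * R * a - m) > 0"
  proof -
    have eq: "p * (2 * S * b - n) + q * (2 * S * a - m) = 2 * S * (p * b + q * a) - (p * n + q * m)" for S
      by (simp add: algebra_simps)
    have "p * n + q * m \<ge> 0" using nn by simp
    then have "2 * R * (p * b + q * a) > 0" using g unfolding eq by linarith
    then have "p * b + q * a \<ge> 0" using assms by (simp add: zero_less_mult_iff)
    from mono[OF this] show ?thesis using g unfolding eq by linarith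
  qed
  moreover have "x < 2 * R' * y" if "x < 2 * R * y" "0 \<le> x" for x y
  proof -
    have "y > 0" using that assms by (smt (verit) zero_less_mult_iff)
    then show ?thesis using mono[of y] that by linarith
  qed
  ultimately show "z \<in> patch \<alpha> \<beta> R'"
    using z nn unfolding patch_def defs[symmetric] by (auto simp flip: defs)
qed

section \<open>Growing the squares to a quadrant\<close>

definition quadrant_hull :: "real \<Rightarrow> real \<Rightarrow> (complex \<times> complex) set" where
  "quadrant_hull \<alpha> \<beta> = tube_pos \<union> tube_neg \<union>
     {z. \<bar>Im (fst z)\<bar> * (Re (snd z) - \<beta>) + \<bar>Im (snd z)\<bar> * (Re (fst z) - \<alpha>) > 0} \<union>
     {z. Re (fst z) > \<alpha> \<and> Re (snd z) > \<beta>}"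

text \<open>After division by 2 R the quadratic terms of \<open>patch\<close> tend to 0, so each
  strict inequality of the hull holds in a patch with R large. Conversely, dropping these
  nonnegative terms leaves the inequalities of the hull.\<close>

lemma quadrant_hull_eq: "quadrant_hull \<alpha> \<beta> = (\<Union>R\<in>{0<..}. patch \<alpha> \<beta> R)"
proof (intro equalityI subsetI)
  fix z assume z: "z \<in> quadrant_hull \<alpha> \<beta>"
  define a b p q m n where "a = Re (fst z) - \<alpha>" and "b = Re (snd z) - \<beta>" and "p = \<bar>Im (fst z)\<bar>"
    and "q = \<bar>Im (snd z)\<bar>" and "m = (norm (fst z - of_real \<alpha>))\<^sup>2" and "n = (norm (snd z - of_real \<beta>))\<^sup>2"
  note defs = a_def b_def p_def q_def m_def n_def
  have nn: "p \<ge> 0" "q \<ge> 0" "m \<ge> 0" "n \<ge> 0" by (simp_all add: defs)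
  have ex: "\<exists>R>0. x < 2 * R * y" if "y > 0" "x \<ge> 0" for x y :: real
    using that by (intro exI[of _ "x / (2 * y) + 1"]) (auto simp: field_simps add_nonneg_pos)
  consider (T) "z \<in> tube_pos \<union> tube_neg" | (g) "p * b + q * a > 0" | (c) "a > 0" "b > 0"
    using z unfolding quadrant_hull_def defs[symmetric] by (auto simp: defs)
  then show "z \<in> (\<Union>R\<in>{0<..}. patch \<alpha> \<beta> R)"
  proof cases
    case T
    then have "z \<in> patch \<alpha> \<beta> 1" by (auto simp: patch_def)
    then show ?thesis by (intro UN_I[of 1]) auto
  next
    case g
    then obtain R where R: "R > 0" "p * n + q * m < 2 * R * (p * b + q * a)"
      using ex[of "p * b + q * a" "p * n + q * m"] nn by auto
    then have "p * (2 * R * b - n) + q * (2 * R * a - m) > 0" by (simp add: algebra_simps)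
    then have "z \<in> patch \<alpha> \<beta> R" unfolding patch_def defs by blast
    then show ?thesis using R by auto
  next
    case c
    obtain R1 R2 where R: "R1 > 0" "m < 2 * R1 * a" "R2 > 0" "n < 2 * R2 * b"
      using ex[OF c(1), of m] ex[OF c(2), of n] nn by auto
    have "2 * R1 * a \<le> 2 * (R1 + R2) * a" "2 * R2 * b \<le> 2 * (R1 + R2) * b"
      using R c by (auto intro!: mult_right_mono)
    then have "z \<in> patch \<alpha> \<beta> (R1 + R2)" using R unfolding patch_def defs by auto
    then show ?thesis using R by (intro UN_I[of "R1 + R2"]) auto
  qed
next
  fix z assume "z \<in> (\<Union>R\<in>{0<..}. patch \<alpha> \<beta> R)"
  then obtain R where R: "R > 0" and z: "z \<in> patch \<alpha> \<beta> R" by auto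
  define a b p q m n where "a = Re (fst z) - \<alpha>" and "b = Re (snd z) - \<beta>" and "p = \<bar>Im (fst z)\<bar>"
    and "q = \<bar>Im (snd z)\<bar>" and "m = (norm (fst z - of_real \<alpha>))\<^sup>2" and "n = (norm (snd z - of_real \<beta>))\<^sup>2"
  note defs = a_def b_def p_def q_def m_def n_def
  have nn: "p \<ge> 0" "q \<ge> 0" "m \<ge> 0" "n \<ge> 0" by (simp_all add: defs)
  consider (T) "z \<in> tube_pos \<union> tube_neg" | (g) "p * (2 * R * b - n) + q * (2 * R * a - m) > 0"
    | (c) "m < 2 * R * a" "n < 2 * R * b"
    using z unfolding patch_def defs by blast
  then show "z \<in> quadrant_hull \<alpha> \<beta>"
  proof cases
    case T
    then show ?thesis by (auto simp: quadrant_hull_def)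
  next
    case g
    have "p * (2 * R * b - n) + q * (2 * R * a - m) = 2 * R * (p * b + q * a) - (p * n + q * m)"
      by (simp add: algebra_simps)
    moreover have "p * n + q * m \<ge> 0" using nn by simp
    ultimately have "2 * R * (p * b + q * a) > 0" using g by linarith
    then have "p * b + q * a > 0" using R by (simp add: zero_less_mult_iff)
    then show ?thesis unfolding quadrant_hull_def defs by blast
  next
    case c
    then have "2 * R * a > 0" "2 * R * b > 0" using nn by linarith+
    then have "a > 0" "b > 0" using R by (simp_all add: zero_less_mult_iff)
    then show ?thesis by (simp add: quadrant_hull_def defs)
  qed
qed

lemma tube_pos_nonempty: "(\<i>, \<i>) \<in> tube_pos" by (simp add: tube_pos_def)

lemma open_quadrant_hull: "open (quadrant_hull \<alpha> \<beta>)"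
  unfolding quadrant_hull_eq by (intro open_UN ballI open_patch)

text \<open>The patches are nested, and \<open>tube_pos\<close> lies in all of them and anchors the
  gluing. Agreement is recorded on this tube; on the other one it is recovered at the end by the
  identity theorem.\<close>

lemma quadrant_hull_extension:
  assumes f: "holo2 f G" and G: "open G" "tube_pos \<subseteq> G" "tube_neg \<subseteq> G"
    and diag: "\<And>x::real. 0 \<le> x \<Longrightarrow> (of_real (\<alpha> + x), of_real (\<beta> + x)) \<in> G"
  obtains F where "holo2 F (quadrant_hull \<alpha> \<beta>)" "\<And>z. z \<in> tube_pos \<Longrightarrow> F z = f z"
proof -
  have "\<forall>R\<in>{0<..}. \<exists>F. holo2 F (patch \<alpha> \<beta> R) \<and> (\<forall>z\<in>tube_pos. F z = f z)"
  proof
    fix R :: real assume "R \<in> {0<..}"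
    then show "\<exists>F. holo2 F (patch \<alpha> \<beta> R) \<and> (\<forall>z\<in>tube_pos. F z = f z)"
      using patch_extension[of R, OF _ f G diag] by (metis UnI1 greaterThan_iff)
  qed
  then obtain F where F: "\<And>R. R > 0 \<Longrightarrow> holo2 (F R) (patch \<alpha> \<beta> R)" "\<And>R z. R > 0 \<Longrightarrow> z \<in> tube_pos \<Longrightarrow> F R z = f z"
    by (metis greaterThan_iff)
  have TPsub: "tube_pos \<subseteq> patch \<alpha> \<beta> R" for R by (auto simp: patch_def)
  have "connected (patch \<alpha> \<beta> R \<inter> patch \<alpha> \<beta> R')" if "R > 0" "R' > 0" for R R'
    using that patch_mono[of R R' \<alpha> \<beta>] patch_mono[of R' R \<alpha> \<beta>] connected_patch[of R \<alpha> \<beta>] connected_patch[of R' \<alpha> \<beta>]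
    by (metis inf.absorb1 inf.absorb2 linear)
  then obtain H where H: "holo2 H (\<Union>R\<in>{0<..}. patch \<alpha> \<beta> R)"
      "\<And>R z. R \<in> {0<..} \<Longrightarrow> z \<in> patch \<alpha> \<beta> R \<Longrightarrow> H z = F R z"
    using holo2_glue[of "{0<..}" "patch \<alpha> \<beta>" F tube_pos f] open_patch open_tube_pos tube_pos_nonempty F TPsub
    by (smt (verit) empty_iff greaterThan_iff)
  show ?thesis
  proof (rule that[of H])
    show "holo2 H (quadrant_hull \<alpha> \<beta>)" using H(1) by (simp add: quadrant_hull_eq)
    show "H z = f z" if "z \<in> tube_pos" for z
      using that H(2)[of 1 z] F(2)[of 1 z] TPsub[of 1] by auto
  qed
qed

text \<open>A hull is stable under adding the same nonnegative real to both coordinates. Each such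
  ray enters the convex quadrant \<open>Q\<close> above both corners, so the intersection is a union
  of connected sets containing \<open>Q\<close>.\<close>

lemma connected_quadrant_hull_Int: "connected (quadrant_hull \<alpha> \<beta> \<inter> quadrant_hull \<alpha>' \<beta>')" (is "connected ?S")
proof -
  define M N where "M = max \<alpha> \<alpha>'" and "N = max \<beta> \<beta>'"
  define Q where "Q = {z :: complex \<times> complex. Re (fst z) > M \<and> Re (snd z) > N}"
  have "Q = {w. Re w > M} \<times> {w. Re w > N}" by (auto simp: Q_def)
  then have Q: "connected Q"
    by (simp add: convex_connected convex_Times convex_halfspace_Re_gt)
  have "Q \<subseteq> ?S" by (auto simp: Q_def M_def N_def quadrant_hull_def)
  have shift: "(fst z + of_real s, snd z + of_real s) \<in> quadrant_hull a b"
    if z: "z \<in> quadrant_hull a b" and s: "s \<ge> 0" for z a b s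
  proof -
    have "\<bar>Im (fst z)\<bar> * (Re (snd z) - b) + \<bar>Im (snd z)\<bar> * (Re (fst z) - a)
      \<le> \<bar>Im (fst z)\<bar> * (Re (snd z) + s - b) + \<bar>Im (snd z)\<bar> * (Re (fst z) + s - a)"
      using s by (intro add_mono mult_left_mono) auto
    then show ?thesis using z s unfolding quadrant_hull_def tube_pos_def tube_neg_def by auto
  qed
  define C where "C z = (\<lambda>s::real. (fst z + of_real s, snd z + of_real s)) ` {0..}" for z :: "complex \<times> complex"
  have C: "connected (C z)" for z
    unfolding C_def by (intro connected_continuous_image continuous_intros) (simp add: convex_connected)
  have meet: "C z \<inter> Q \<noteq> {}" for z
  proof -
    define s where "s = \<bar>M - Re (fst z)\<bar> + \<bar>N - Re (snd z)\<bar> + 1"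
    have "(fst z + of_real s, snd z + of_real s) \<in> C z"
      unfolding C_def by (rule image_eqI[of _ _ s]) (auto simp: s_def)
    moreover have "(fst z + of_real s, snd z + of_real s) \<in> Q"
      by (simp add: Q_def s_def) linarith
    ultimately show ?thesis by blast
  qed
  have "z \<in> C z" for z by (auto simp: C_def intro!: image_eqI[of _ _ 0])
  moreover have "C z \<subseteq> ?S" if "z \<in> ?S" for z using that shift by (auto simp: C_def)
  ultimately have eq: "?S = (\<Union>z\<in>?S. C z \<union> Q)" using \<open>Q \<subseteq> ?S\<close> by blast
  have "(of_real M + 1, of_real N + 1) \<in> Q" by (simp add: Q_def)
  then have "\<Inter> ((\<lambda>z. C z \<union> Q) ` ?S) \<noteq> {}" by blast
  then have "connected (\<Union>z\<in>?S. C z \<union> Q)"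
    using C Q meet by (intro connected_Union) (auto intro!: connected_Un)
  then show ?thesis using eq by simp
qed

section \<open>The union over all corners above the hyperbola\<close>

definition lc_envelope :: "real \<Rightarrow> (complex \<times> complex) set" where
  "lc_envelope \<mu> = (\<Union>(\<alpha>, \<beta>)\<in>{(\<alpha>, \<beta>). \<alpha> > 0 \<and> \<beta> > 0 \<and> \<alpha> * \<beta> > \<mu>\<^sup>2}. quadrant_hull \<alpha> \<beta>)"

lemma lc_envelope_index_nonempty: "{(\<alpha>, \<beta>). \<alpha> > 0 \<and> \<beta> > 0 \<and> \<alpha> * \<beta> > (\<mu>::real)\<^sup>2} \<noteq> {}"
proof -
  have "(1, \<mu>\<^sup>2 + 1) \<in> {(\<alpha>, \<beta>). \<alpha> > 0 \<and> \<beta> > 0 \<and> \<alpha> * \<beta> > \<mu>\<^sup>2}" by (simp add: add_nonneg_pos)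
  then show ?thesis by blast
qed

lemma tube_pos_subset_lc_envelope: "tube_pos \<subseteq> lc_envelope \<mu>" and tube_neg_subset_lc_envelope: "tube_neg \<subseteq> lc_envelope \<mu>"
  using lc_envelope_index_nonempty[of \<mu>] unfolding lc_envelope_def quadrant_hull_def by fastforce+

lemma open_lc_envelope: "open (lc_envelope \<mu>)"
  unfolding lc_envelope_def using open_quadrant_hull by auto

lemma connected_lc_envelope: "connected (lc_envelope \<mu>)"
proof -
  have "(\<i>, \<i>) \<in> quadrant_hull \<alpha> \<beta>" for \<alpha> \<beta> using tube_pos_nonempty by (simp add: quadrant_hull_def)
  moreover have "connected (quadrant_hull \<alpha> \<beta>)" for \<alpha> \<beta>
    using connected_quadrant_hull_Int[of \<alpha> \<beta> \<alpha> \<beta>] by simp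
  ultimately have "connected (quadrant_hull (fst i) (snd i))" "(\<i>, \<i>) \<in> quadrant_hull (fst i) (snd i)" for i
    by blast+
  then show ?thesis unfolding lc_envelope_def case_prod_unfold by (intro connected_Union) blast+
qed

lemma lc_envelope_extension:
  assumes f: "holo2 f G" and G: "open G" "tube_pos \<subseteq> G" "tube_neg \<subseteq> G"
    and real: "\<And>x y::real. x > 0 \<Longrightarrow> y > 0 \<Longrightarrow> x * y > \<mu>\<^sup>2 \<Longrightarrow> (of_real x, of_real y) \<in> G"
  obtains F where "holo2 F (lc_envelope \<mu>)" "\<And>z. z \<in> tube_pos \<Longrightarrow> F z = f z"
proof -
  define I where "I = {(\<alpha>, \<beta>). \<alpha> > 0 \<and> \<beta> > 0 \<and> \<alpha> * \<beta> > \<mu>\<^sup>2}"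
  have "\<forall>i\<in>I. \<exists>F. holo2 F (quadrant_hull (fst i) (snd i)) \<and> (\<forall>z\<in>tube_pos. F z = f z)"
  proof
    fix i assume i: "i \<in> I"
    have "(of_real (fst i + x), of_real (snd i + x)) \<in> G" if "0 \<le> x" for x :: real
    proof (rule real)
      \<comment> \<open>The product of the coordinates grows along the diagonal ray, so the ray from
        the corner stays above the hyperbola.\<close>
      have "fst i * snd i \<le> (fst i + x) * (snd i + x)" using i that by (intro mult_mono) (auto simp: I_def)
      then show "\<mu>\<^sup>2 < (fst i + x) * (snd i + x)" using i by (auto simp: I_def)
    qed (use i that in \<open>auto simp: I_def\<close>)
    then show "\<exists>F. holo2 F (quadrant_hull (fst i) (snd i)) \<and> (\<forall>z\<in>tube_pos. F z = f z)"
      using quadrant_hull_extension[OF f G] by metis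
  qed
  then obtain F where F: "\<And>i. i \<in> I \<Longrightarrow> holo2 (F i) (quadrant_hull (fst i) (snd i))"
      "\<And>i z. i \<in> I \<Longrightarrow> z \<in> tube_pos \<Longrightarrow> F i z = f z"
    by metis
  have TPsub: "tube_pos \<subseteq> quadrant_hull \<alpha> \<beta>" for \<alpha> \<beta> by (auto simp: quadrant_hull_def)
  obtain H where H: "holo2 H (\<Union>i\<in>I. quadrant_hull (fst i) (snd i))"
      "\<And>i z. i \<in> I \<Longrightarrow> z \<in> quadrant_hull (fst i) (snd i) \<Longrightarrow> H z = F i z"
  proof (rule holo2_glue[of I "\<lambda>i. quadrant_hull (fst i) (snd i)" F tube_pos f])
    show "tube_pos \<noteq> {}" using tube_pos_nonempty by blast
  qed (use open_quadrant_hull connected_quadrant_hull_Int F TPsub open_tube_pos in auto)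
  show ?thesis
  proof (rule that[of H])
    show "holo2 H (lc_envelope \<mu>)" using H(1) by (simp add: lc_envelope_def I_def case_prod_unfold)
    show "H z = f z" if "z \<in> tube_pos" for z
    proof -
      obtain i where "i \<in> I" using lc_envelope_index_nonempty[of \<mu>] unfolding I_def by blast
      then show ?thesis using that H(2)[of i z] F(2)[of i z] TPsub by auto
    qed
  qed
qed

text \<open>For positive \<mu>, r, s the line s \<alpha> + r \<beta> = 2 \<mu> sqrt(r s) is tangent
  to the hyperbola \<alpha> \<beta> = \<mu>^2. The weights are crossed because the hull pairs the
  imaginary part of one coordinate with the real part of the other.\<close>

lemma weighted_arith_geo:
  assumes "r \<ge> 0" "s \<ge> 0" "\<alpha> > 0" "\<beta> > 0" "\<alpha> * \<beta> \<ge> \<mu>\<^sup>2"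
  shows "2 * \<mu> * sqrt (r * s) \<le> r * \<beta> + s * (\<alpha>::real)"
proof -
  have "\<mu> \<le> sqrt (\<alpha> * \<beta>)" using assms by (intro real_le_rsqrt)
  then have "2 * \<mu> * sqrt (r * s) \<le> 2 * (sqrt (\<alpha> * \<beta>) * sqrt (r * s))"
    using assms by (simp add: mult_right_mono)
  also have "sqrt (\<alpha> * \<beta>) * sqrt (r * s) = sqrt ((r * \<beta>) * (s * \<alpha>))"
    by (simp add: real_sqrt_mult)
  also have "2 * \<dots> \<le> r * \<beta> + s * \<alpha>"
    using arith_geo_mean_sqrt[of "r * \<beta>" "s * \<alpha>"] assms by simp
  finally show ?thesis .
qed

text \<open>With p, q the absolute imaginary parts, the best corner makes p \<beta> + q \<alpha>
  small; its infimum over \<alpha> \<beta> > \<mu>^2 is 2 \<mu> sqrt(p q). The strict inequality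
  leaves room for a corner strictly above the hyperbola.\<close>

lemma lc_envelope_eq:
  assumes "\<mu> \<ge> 0"
  shows "lc_envelope \<mu> = tube_pos \<union> tube_neg \<union>
     {z. \<bar>Im (fst z)\<bar> * Re (snd z) + \<bar>Im (snd z)\<bar> * Re (fst z) > 2 * \<mu> * sqrt (\<bar>Im (fst z)\<bar> * \<bar>Im (snd z)\<bar>)} \<union>
     {z. Re (fst z) > 0 \<and> Re (fst z) * Re (snd z) > \<mu>\<^sup>2}" (is "_ = ?E")
proof (intro equalityI subsetI)
  fix z assume "z \<in> lc_envelope \<mu>"
  then obtain \<alpha> \<beta> where ab: "\<alpha> > 0" "\<beta> > 0" "\<alpha> * \<beta> > \<mu>\<^sup>2" and z: "z \<in> quadrant_hull \<alpha> \<beta>"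
    by (auto simp: lc_envelope_def)
  consider (T) "z \<in> tube_pos \<union> tube_neg"
    | (g) "\<bar>Im (fst z)\<bar> * (Re (snd z) - \<beta>) + \<bar>Im (snd z)\<bar> * (Re (fst z) - \<alpha>) > 0"
    | (c) "Re (fst z) > \<alpha>" "Re (snd z) > \<beta>"
    using z unfolding quadrant_hull_def by blast
  then show "z \<in> ?E"
  proof cases
    case g
    then show ?thesis
      using weighted_arith_geo[of "\<bar>Im (fst z)\<bar>" "\<bar>Im (snd z)\<bar>" \<alpha> \<beta> \<mu>] ab
      by (simp add: algebra_simps)
  next
    case c
    then have "\<alpha> * \<beta> < Re (fst z) * Re (snd z)" using ab by (intro mult_strict_mono) auto
    then show ?thesis using ab c by auto
  qed auto
next
  fix z assume z: "z \<in> ?E"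
  define a b p q where "a = Re (fst z)" and "b = Re (snd z)" and "p = \<bar>Im (fst z)\<bar>" and "q = \<bar>Im (snd z)\<bar>"
  note defs = a_def b_def p_def q_def
  have nn: "p \<ge> 0" "q \<ge> 0" by (simp_all add: defs)
  have envI: "z \<in> lc_envelope \<mu>" if "\<alpha> > 0" "\<beta> > 0" "\<alpha> * \<beta> > \<mu>\<^sup>2"
    "p * (b - \<beta>) + q * (a - \<alpha>) > 0 \<or> a > \<alpha> \<and> b > \<beta>" for \<alpha> \<beta>
    using that unfolding lc_envelope_def quadrant_hull_def defs by blast
  have big: "x * ((\<mu>\<^sup>2 + 1) / x) > \<mu>\<^sup>2" "(\<mu>\<^sup>2 + 1) / x > 0" if "x > 0" for x
    using that by (auto simp: add_nonneg_pos)
  consider (T) "z \<in> tube_pos \<union> tube_neg" | (g) "p * b + q * a > 2 * \<mu> * sqrt (p * q)" | (c) "a > 0" "a * b > \<mu>\<^sup>2"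
    using z unfolding defs by blast
  then show "z \<in> lc_envelope \<mu>"
  proof cases
    case T
    then show ?thesis using tube_pos_subset_lc_envelope tube_neg_subset_lc_envelope by blast
  next
    case g
    consider "p = 0" "q = 0" | "p = 0" "q > 0" | "p > 0" "q = 0" | "p > 0" "q > 0"
      using nn by fastforce
    then show ?thesis
    proof cases
      case 1
      then show ?thesis using g by simp
    next
      \<comment> \<open>With \<open>p = 0\<close> the hull condition reduces to
        \<open>\<alpha> < a\<close>, so half of \<open>a\<close> serves and \<open>\<beta>\<close>
        is made large enough for the hyperbola. The next case is the mirror image.\<close>
      case 2
      then have "a > 0" using g by (simp add: zero_less_mult_iff)
      then show ?thesis using 2 big[of "a / 2"] by (intro envI[of "a / 2" "(\<mu>\<^sup>2 + 1) / (a / 2)"]) auto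
    next
      case 3
      then have "b > 0" using g by (simp add: zero_less_mult_iff)
      then show ?thesis using 3 big[of "b / 2"] by (intro envI[of "(\<mu>\<^sup>2 + 1) / (b / 2)" "b / 2"]) auto
    next
      case 4
      define s where "s = sqrt (p * q)"
      have s: "s > 0" "s * s = p * q" using 4 by (simp_all add: s_def)
      have "\<mu> < (p * b + q * a) / (2 * s)" using g s by (simp add: s_def[symmetric] field_simps)
      then obtain m where m: "\<mu> < m" "m < (p * b + q * a) / (2 * s)" using dense by blast
      \<comment> \<open>the corner on the hyperbola \<open>\<alpha> \<beta> = m\<^sup>2\<close> that minimises \<open>p \<beta> + q \<alpha>\<close>\<close>
      define \<alpha> \<beta> where "\<alpha> = m * p / s" and "\<beta> = m * q / s"
      have "m > 0" using m assms by linarith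
      have "\<alpha> * \<beta> = m * m * (p * q) / (s * s)" by (simp add: \<alpha>_def \<beta>_def)
      also have "\<dots> = m\<^sup>2" using s 4 by (simp add: power2_eq_square)
      finally have "\<alpha> * \<beta> > \<mu>\<^sup>2" using m assms by (simp add: power_strict_mono)
      moreover have "p * \<beta> + q * \<alpha> = 2 * m * (p * q) / s" by (simp add: \<alpha>_def \<beta>_def field_simps)
      then have "p * \<beta> + q * \<alpha> = 2 * m * s" unfolding s(2)[symmetric] using s(1) by simp
      moreover have "2 * m * s < p * b + q * a" using m s by (simp add: field_simps)
      ultimately show ?thesis
        using \<open>m > 0\<close> s 4 by (intro envI[of \<alpha> \<beta>]) (auto simp: \<alpha>_def \<beta>_def algebra_simps)
    qed
  next
    case c
    then have "b > 0" using assms by (smt (verit) mult_nonneg_nonpos zero_le_power2)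
    have "\<mu>\<^sup>2 / b < a" using c \<open>b > 0\<close> by (simp add: field_simps)
    \<comment> \<open>Here \<open>(a, b)\<close> is itself above the hyperbola; first
      \<open>\<alpha>\<close>, then \<open>\<beta>\<close>, is lowered so little that the product
      still exceeds \<open>\<mu>\<^sup>2\<close>.\<close>
    then obtain \<alpha> where \<alpha>: "\<mu>\<^sup>2 / b < \<alpha>" "\<alpha> < a" using dense by blast
    have "\<mu>\<^sup>2 / b \<ge> 0" using \<open>b > 0\<close> by simp
    then have "\<alpha> > 0" using \<alpha> by linarith
    have "\<mu>\<^sup>2 / \<alpha> < b" using \<alpha> \<open>b > 0\<close> \<open>\<alpha> > 0\<close> by (simp add: field_simps)
    then obtain \<beta> where \<beta>: "\<mu>\<^sup>2 / \<alpha> < \<beta>" "\<beta> < b" using dense by blast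
    have "\<mu>\<^sup>2 / \<alpha> \<ge> 0" using \<open>\<alpha> > 0\<close> by simp
    then have "\<beta> > 0" using \<beta> by linarith
    then show ?thesis
      using \<alpha> \<beta> \<open>\<alpha> > 0\<close> by (intro envI[of \<alpha> \<beta>]) (auto simp: field_simps)
  qed
qed

section \<open>Complex lines in the complement\<close>

lemma line_through_complement_lc_envelope:
  assumes "\<mu> \<ge> 0" "z \<notin> lc_envelope \<mu>"
  obtains r s c where "r \<ge> 0" "s \<ge> 0" "r + s > 0" "c \<le> 2 * \<mu> * sqrt (r * s)"
    "of_real s * fst z + of_real r * snd z = of_real c"
proof -
  define a b p q where "a = Re (fst z)" and "b = Re (snd z)" and "p = Im (fst z)" and "q = Im (snd z)"
  note defs = a_def b_def p_def q_def
  have T: "\<not> (p > 0 \<and> q > 0)" "\<not> (p < 0 \<and> q < 0)"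
    and g: "\<bar>p\<bar> * b + \<bar>q\<bar> * a \<le> 2 * \<mu> * sqrt (\<bar>p\<bar> * \<bar>q\<bar>)" and c: "\<not> (a > 0 \<and> a * b > \<mu>\<^sup>2)"
    using assms(2) unfolding lc_envelope_eq[OF assms(1)] tube_pos_def tube_neg_def defs by auto
  note outer = that
  have line: thesis if "r \<ge> 0" "s \<ge> 0" "r + s > 0" "s * a + r * b \<le> 2 * \<mu> * sqrt (r * s)" "s * p + r * q = 0" for r s
    by (rule outer[of r s "s * a + r * b"]) (use that in \<open>auto simp: complex_eq_iff defs\<close>)
  show thesis
  proof (cases "p = 0 \<and> q = 0")
    case False
    \<comment> \<open>Since \<open>p\<close> and \<open>q\<close> have weakly opposite signs, these
      weights cancel the imaginary part of s u + r v, and the failed envelope inequality is exactly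
      the bound on the constant.\<close>
    show thesis
      by (rule line[of "\<bar>p\<bar>" "\<bar>q\<bar>"]) (use False g T in \<open>auto simp: abs_if algebra_simps split: if_splits\<close>)
  next
    case True
    consider "a \<le> 0" | "b \<le> 0" | "a > 0" "b > 0" "a * b \<le> \<mu>\<^sup>2" using c by fastforce
    then show thesis
    proof cases
      case 1
      then show thesis using True by (intro line[of 0 1]) auto
    next
      case 2
      then show thesis using True by (intro line[of 1 0]) auto
    next
      case 3
      \<comment> \<open>The line is the tangent at \<open>(a, b)\<close> to the hyperbola u v = a b:
        weights \<open>r = a\<close>, \<open>s = b\<close> and constant
        \<open>2 * a * b\<close>.\<close>
      have "sqrt (a * b) \<le> \<mu>" using 3 assms(1) by (simp add: real_le_lsqrt)
      then have "sqrt (a * b) * sqrt (a * b) \<le> \<mu> * sqrt (a * b)" using 3 by (intro mult_right_mono) auto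
      then show thesis using 3 True by (intro line[of a b]) (auto simp: algebra_simps)
    qed
  qed
qed

text \<open>The imaginary part of the line equation excludes both tubes and makes the absolute
  imaginary parts a nonnegative multiple of \<open>(r, s)\<close>. The hull inequality then
  contradicts the arithmetic-geometric bound on \<open>c\<close>.\<close>

lemma line_avoids_lc_envelope:
  assumes r: "r \<ge> 0" "s \<ge> 0" "r + s > 0" and c: "c \<le> 2 * \<mu> * sqrt (r * s)" and z: "z \<in> lc_envelope \<mu>"
  shows "of_real s * fst z + of_real r * snd z \<noteq> of_real c"
proof
  assume eq: "of_real s * fst z + of_real r * snd z = of_real c"
  define a b p q where "a = Re (fst z)" and "b = Re (snd z)" and "p = Im (fst z)" and "q = Im (snd z)"
  note defs = a_def b_def p_def q_def
  have re: "s * a + r * b = c" and im: "s * p + r * q = 0"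
    using eq by (auto simp: complex_eq_iff defs)
  obtain \<alpha> \<beta> where ab: "\<alpha> > 0" "\<beta> > 0" "\<alpha> * \<beta> > \<mu>\<^sup>2" and z: "z \<in> quadrant_hull \<alpha> \<beta>"
    using z by (auto simp: lc_envelope_def)
  have "c \<le> r * \<beta> + s * \<alpha>" using weighted_arith_geo[of r s \<alpha> \<beta> \<mu>] ab r c by simp
  then have le: "r * (b - \<beta>) + s * (a - \<alpha>) \<le> 0" using re by (simp add: algebra_simps)
  \<comment> \<open>One of the weights may be 0, so strictness is drawn from the lower bound
    \<open>min x y * (r + s)\<close>.\<close>
  have wpos: "s * x + r * y > 0" if "x > 0" "y > 0" for x y
  proof -
    have "min x y * (r + s) \<le> s * x + r * y"
      using r mult_left_mono[of "min x y" x s] mult_left_mono[of "min x y" y r] by (simp add: algebra_simps)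
    moreover have "min x y * (r + s) > 0" using r that by simp
    ultimately show ?thesis by linarith
  qed
  consider (pos) "p > 0" "q > 0" | (neg) "p < 0" "q < 0" | (g) "\<bar>p\<bar> * (b - \<beta>) + \<bar>q\<bar> * (a - \<alpha>) > 0"
    | (c) "a > \<alpha>" "b > \<beta>"
    using z unfolding quadrant_hull_def tube_pos_def tube_neg_def defs by blast
  then show False
  proof cases
    case pos
    then show False using wpos[of p q] im by simp
  next
    case neg
    then show False using wpos[of "- p" "- q"] im by simp
  next
    case g
    have "s * p = - (r * q)" using im by linarith
    then have "\<bar>s * p\<bar> = \<bar>r * q\<bar>" by simp
    then have sp: "s * \<bar>p\<bar> = r * \<bar>q\<bar>" using r by (simp add: abs_mult)
    define k where "k = (\<bar>p\<bar> + \<bar>q\<bar>) / (r + s)"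
    have k: "k \<ge> 0" "\<bar>p\<bar> = k * r" "\<bar>q\<bar> = k * s"
      using r sp by (auto simp: k_def field_simps)
    have "\<bar>p\<bar> * (b - \<beta>) + \<bar>q\<bar> * (a - \<alpha>) = k * (r * (b - \<beta>) + s * (a - \<alpha>))"
      unfolding k by (simp add: algebra_simps)
    also have "\<dots> \<le> 0" using k(1) le by (rule mult_nonneg_nonpos)
    finally show False using g by linarith
  next
    case c
    then show False using wpos[of "a - \<alpha>" "b - \<beta>"] le by linarith
  qed
qed

subsection \<open>Return to Minkowski coordinates\<close>

definition lightcone :: "complex \<times> complex \<Rightarrow> complex \<times> complex" where
  "lightcone z = (fst z + snd z, fst z - snd z)"

definition lightcone_inv :: "complex \<times> complex \<Rightarrow> complex \<times> complex" where
  "lightcone_inv w = ((fst w + snd w) / 2, (fst w - snd w) / 2)"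

lemma lightcone_lightcone_inv: "lightcone (lightcone_inv w) = w" and lightcone_inv_lightcone: "lightcone_inv (lightcone z) = z"
  by (simp_all add: lightcone_def lightcone_inv_def prod_eq_iff field_simps)

lemma continuous_on_lightcone: "continuous_on S lightcone" and continuous_on_lightcone_inv: "continuous_on S lightcone_inv"
  unfolding lightcone_def lightcone_inv_def by (intro continuous_intros; simp)+

lemma holo2_lightcone: "holo2 f S \<Longrightarrow> holo2 (\<lambda>z. f (lightcone z)) (lightcone -` S)"
  unfolding lightcone_def by (rule holo2_pair_compose) (auto simp: lightcone_def intro!: holo2_intros)

lemma holo2_lightcone_inv: "holo2 f S \<Longrightarrow> holo2 (\<lambda>w. f (lightcone_inv w)) (lightcone_inv -` S)"
  unfolding lightcone_inv_def by (rule holo2_pair_compose) (auto simp: lightcone_inv_def intro!: holo2_intros)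

lemma connected_vimage_lightcone: "connected S \<Longrightarrow> connected (lightcone -` S)"
proof -
  assume "connected S"
  moreover have "lightcone -` S = lightcone_inv ` S" by (auto simp: lightcone_lightcone_inv intro: image_eqI[where f = lightcone_inv, OF lightcone_inv_lightcone[symmetric]])
  ultimately show ?thesis using continuous_on_lightcone_inv connected_continuous_image by metis
qed

lemma open_vimage_lightcone: "open S \<Longrightarrow> open (lightcone -` S)"
  using continuous_on_lightcone by (rule open_vimage[rotated])

lemma prod_sum_pos: "x * y > 0 \<and> x + y > 0 \<longleftrightarrow> x > 0 \<and> y > (0::real)"
  by (auto simp: zero_less_mult_iff)

lemma Vplus_iff: "x \<in> Vplus \<longleftrightarrow> fst x + snd x > 0 \<and> fst x - snd x > 0"
proof -
  have "msq x = (fst x + snd x) * (fst x - snd x)" by (simp add: msq_def mink_def algebra_simps)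
  moreover have "fst x > 0 \<longleftrightarrow> (fst x + snd x) + (fst x - snd x) > 0" by simp
  ultimately show ?thesis unfolding Vplus_def mem_Collect_eq by (simp only: prod_sum_pos)
qed

lemma Tplus_eq: "Tplus = lightcone -` tube_pos"
  by (auto simp: Tplus_def Vplus_iff Im2_def tube_pos_def lightcone_def)

lemma Tminus_eq: "Tminus = lightcone -` tube_neg"
proof -
  have "y \<in> Vminus \<longleftrightarrow> - y \<in> Vplus" for y unfolding Vminus_def by (metis image_iff minus_minus)
  then show ?thesis by (auto simp: Tminus_def Vplus_iff Im2_def tube_neg_def lightcone_def)
qed

lemma Vmu_plus_iff:
  "x \<in> Vmu_plus \<mu> \<longleftrightarrow> fst x + snd x > 0 \<and> (fst x + snd x) * (fst x - snd x) > \<mu>\<^sup>2"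
proof -
  have *: "msq x = (fst x + snd x) * (fst x - snd x)" by (simp add: msq_def mink_def algebra_simps)
  have **: "fst x > 0 \<longleftrightarrow> (fst x + snd x) + (fst x - snd x) > 0" by simp
  have "a * b > \<mu>\<^sup>2 \<and> a + b > 0 \<longleftrightarrow> a > 0 \<and> a * b > \<mu>\<^sup>2" for a b :: real
    using prod_sum_pos[of a b] zero_le_power2[of \<mu>] by (smt (verit) zero_less_mult_iff)
  then show ?thesis unfolding Vmu_plus_def mem_Collect_eq * ** .
qed

text \<open>Spacelike means that the light-cone coordinates p, q of \<open>y\<close> have opposite
  signs. Then \<open>sgn (snd y)\<close> is the sign of p and of -q, which turns the product into
  absolute values, and the normalising root is sqrt(|p| |q|).\<close>

lemma mink_yhat:
  assumes "msq y < 0"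
  shows "mink x (yhat y) > \<mu> \<longleftrightarrow>
    \<bar>fst y + snd y\<bar> * (fst x - snd x) + \<bar>fst y - snd y\<bar> * (fst x + snd x)
      > 2 * \<mu> * sqrt (\<bar>fst y + snd y\<bar> * \<bar>fst y - snd y\<bar>)"
proof -
  define p q where "p = fst y + snd y" and "q = fst y - snd y"
  define S where "S = sqrt (\<bar>p\<bar> * \<bar>q\<bar>)"
  have y: "fst y = (p + q) / 2" "snd y = (p - q) / 2" by (simp_all add: p_def q_def)
  have m: "msq y = p * q" by (simp add: msq_def mink_def p_def q_def algebra_simps)
  then have pq: "p > 0 \<and> q < 0 \<or> p < 0 \<and> q > 0" using assms by (auto simp: mult_less_0_iff)
  then have "p \<noteq> 0 \<and> q \<noteq> 0" by auto
  then have S: "S > 0" by (simp add: S_def)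
  have "- (p * q) = \<bar>p\<bar> * \<bar>q\<bar>" using pq by (auto simp: abs_if)
  then have sqrt: "sqrt (- msq y) = S" by (simp add: m S_def)
  have "mink x (yhat y) = sgn (snd y) * (p * (fst x - snd x) - q * (fst x + snd x)) / (2 * S)"
    unfolding mink_def yhat_def sqrt using S by (simp add: y field_simps)
  also have "sgn (snd y) * (p * (fst x - snd x) - q * (fst x + snd x))
      = \<bar>p\<bar> * (fst x - snd x) + \<bar>q\<bar> * (fst x + snd x)"
    using pq by (auto simp: y sgn_if abs_if algebra_simps)
  finally have "mink x (yhat y) = (\<bar>p\<bar> * (fst x - snd x) + \<bar>q\<bar> * (fst x + snd x)) / (2 * S)" .
  then have "mink x (yhat y) > \<mu> \<longleftrightarrow> \<bar>p\<bar> * (fst x - snd x) + \<bar>q\<bar> * (fst x + snd x) > 2 * \<mu> * S"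
    using S by (simp add: less_divide_eq algebra_simps)
  then show ?thesis by (simp add: p_def q_def S_def)
qed

lemma envelope_set_eq:
  assumes "\<mu> \<ge> 0"
  shows "Tplus \<union> Tminus
      \<union> {z. msq (Im2 z) < 0 \<and> mink (Re2 z) (yhat (Im2 z)) > \<mu>}
      \<union> {z. msq (Im2 z) = 0 \<and> Im2 z \<noteq> 0 \<and>
             fst (Re2 z) > snd (Re2 z) * sgn (fst (Im2 z)) * sgn (snd (Im2 z))}
      \<union> {z. Im2 z = 0 \<and> Re2 z \<in> Vmu_plus \<mu>} = lightcone -` lc_envelope \<mu>" (is "?L = _")
proof (rule set_eqI)
  fix z
  define x y where "x = Re2 z" and "y = Im2 z"
  define a b p q where "a = fst x + snd x" and "b = fst x - snd x"
    and "p = fst y + snd y" and "q = fst y - snd y"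
  have lightcone: "Re (fst (lightcone z)) = a" "Re (snd (lightcone z)) = b" "Im (fst (lightcone z)) = p" "Im (snd (lightcone z)) = q"
    by (simp_all add: lightcone_def a_def b_def p_def q_def x_def y_def Re2_def Im2_def)
  have m: "msq y = p * q" by (simp add: msq_def mink_def p_def q_def algebra_simps)
  have tp: "z \<in> Tplus \<longleftrightarrow> p > 0 \<and> q > 0" and tm: "z \<in> Tminus \<longleftrightarrow> p < 0 \<and> q < 0"
    by (simp_all add: Tplus_eq Tminus_eq tube_pos_def tube_neg_def lightcone)
  have L: "z \<in> ?L \<longleftrightarrow> z \<in> Tplus \<or> z \<in> Tminus \<or> msq y < 0 \<and> mink x (yhat y) > \<mu>
      \<or> msq y = 0 \<and> y \<noteq> 0 \<and> fst x > snd x * sgn (fst y) * sgn (snd y)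
      \<or> y = 0 \<and> x \<in> Vmu_plus \<mu>"
    by (auto simp: x_def y_def)
  have E: "z \<in> lightcone -` lc_envelope \<mu> \<longleftrightarrow> p > 0 \<and> q > 0 \<or> p < 0 \<and> q < 0
      \<or> \<bar>p\<bar> * b + \<bar>q\<bar> * a > 2 * \<mu> * sqrt (\<bar>p\<bar> * \<bar>q\<bar>) \<or> a > 0 \<and> a * b > \<mu>\<^sup>2"
    by (auto simp: lc_envelope_eq[OF assms] tube_pos_def tube_neg_def lightcone)
  have V: "x \<in> Vmu_plus \<mu> \<longleftrightarrow> a > 0 \<and> a * b > \<mu>\<^sup>2" by (simp add: Vmu_plus_iff a_def b_def)
  have y0: "y = 0 \<longleftrightarrow> p = 0 \<and> q = 0" by (auto simp: p_def q_def prod_eq_iff)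
  have b: "b > 0" if "a > 0" "a * b > \<mu>\<^sup>2"
    using that zero_le_power2[of \<mu>] by (metis le_less_trans zero_less_mult_pos)
  consider (pos) "p * q > 0" | (neg) "p * q < 0" | (null) "p * q = 0" "y \<noteq> 0" | (zero) "y = 0" by linarith
  then show "z \<in> ?L \<longleftrightarrow> z \<in> lightcone -` lc_envelope \<mu>"
  proof cases
    case pos
    then show ?thesis unfolding L E tp tm by (auto simp: zero_less_mult_iff)
  next
    case neg
    \<comment> \<open>In light-cone form the condition on the real part is not tied to
      \<open>y = 0\<close>. For spacelike \<open>y\<close> it is absorbed by the inequality, through
      the arithmetic-geometric bound at level \<open>sqrt (a * b)\<close>.\<close>
    have "\<bar>p\<bar> * b + \<bar>q\<bar> * a > 2 * \<mu> * sqrt (\<bar>p\<bar> * \<bar>q\<bar>)" if c: "a > 0" "a * b > \<mu>\<^sup>2"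
    proof -
      have "\<mu> < sqrt (a * b)" using c assms by (intro real_less_rsqrt)
      then have "2 * \<mu> * sqrt (\<bar>p\<bar> * \<bar>q\<bar>) < 2 * sqrt (a * b) * sqrt (\<bar>p\<bar> * \<bar>q\<bar>)"
        using neg by (intro mult_strict_right_mono) (auto simp: zero_less_mult_iff)
      also have "\<dots> \<le> \<bar>p\<bar> * b + \<bar>q\<bar> * a"
        using weighted_arith_geo[of "\<bar>p\<bar>" "\<bar>q\<bar>" a b "sqrt (a * b)"] c b by simp
      finally show ?thesis .
    qed
    then show ?thesis
      using neg mink_yhat[of y \<mu> x] unfolding L E tp tm m y0
      by (auto simp: m a_def[symmetric] b_def[symmetric] p_def[symmetric] q_def[symmetric] mult_less_0_iff)
  next
    case null
    \<comment> \<open>For lightlike \<open>y\<close> the root vanishes and the inequality reduces to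
      \<open>a > 0\<close> or \<open>b > 0\<close>; the product of signs in the statement tells
      which.\<close>
    then consider (p) "p = 0" "q \<noteq> 0" | (q) "q = 0" "p \<noteq> 0" by (auto simp: y0)
    then show ?thesis
    proof cases
      case p
      then have "fst y = q / 2" "snd y = - q / 2" by (simp_all add: p_def q_def)
      then have "sgn (fst y) * sgn (snd y) = -1" using p by (simp add: sgn_if)
      then have "snd x * sgn (fst y) * sgn (snd y) = - snd x" by (simp add: mult.assoc)
      then have "fst x > snd x * sgn (fst y) * sgn (snd y) \<longleftrightarrow> a > 0"
        unfolding a_def by linarith
      then show ?thesis unfolding L E tp tm m using p null by (auto simp: zero_less_mult_iff)
    next
      case q
      then have "fst y = p / 2" "snd y = p / 2" by (simp_all add: p_def q_def)
      then have "sgn (fst y) * sgn (snd y) = 1" using q by (simp add: sgn_if)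
      then have "snd x * sgn (fst y) * sgn (snd y) = snd x" by (simp add: mult.assoc)
      then have "fst x > snd x * sgn (fst y) * sgn (snd y) \<longleftrightarrow> b > 0"
        unfolding b_def by linarith
      then show ?thesis unfolding L E tp tm m using q null b by (auto simp: zero_less_mult_iff)
    qed
  next
    case zero
    then show ?thesis unfolding L E tp tm m V using y0 by auto
  qed
qed

section \<open>The complex neighbourhood of the real region and a criterion for domains of
  holomorphy\<close>

lemma open_Vmu_plus: "open (Vmu_plus \<mu>)"
  unfolding Vmu_plus_def msq_def mink_def
  by (intro open_Collect_conj open_Collect_less continuous_intros)

lemma tilde_eq: "tilde B = (\<Union>x\<in>B. ball (emb2 x) (infdist x (frontier B) / 32))"
  by (auto simp: tilde_def dist_norm norm_minus_commute)

lemma infdist_frontier_pos: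
  fixes B :: "(real \<times> real) set"
  assumes "open B" "x \<in> B" "B \<noteq> UNIV" shows "infdist x (frontier B) > 0"
proof (rule infdist_pos_not_in_closed)
  \<comment> \<open>\<open>infdist\<close> to the empty set is 0 by convention, so the frontier must
    be nonempty; this is where \<open>B \<noteq> UNIV\<close> enters.\<close>
  show "frontier B \<noteq> {}" using assms by (auto simp: frontier_eq_empty)
  show "x \<notin> frontier B" using assms by (simp add: frontier_def interior_open)
qed simp

lemma norm_Re2_diff_le: "norm (Re2 z - x) \<le> norm (z - emb2 x)"
proof -
  have le: "(Re w)\<^sup>2 \<le> (norm w)\<^sup>2" for w by (simp add: cmod_power2)
  show ?thesis
    using le[of "fst z - of_real (fst x)"] le[of "snd z - of_real (snd x)"]
    by (auto simp: norm_prod_def Re2_def emb2_def intro!: add_mono)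
qed

text \<open>If the real part were outside \<open>B\<close>, the segment to it from \<open>x\<close>
  would cross the frontier at a point closer to \<open>x\<close> than the frontier is.\<close>

lemma Re2_tilde:
  assumes "z \<in> tilde B" shows "Re2 z \<in> B"
proof (rule ccontr)
  assume "Re2 z \<notin> B"
  obtain x where x: "x \<in> B" "norm (z - emb2 x) < infdist x (frontier B) / 32"
    using assms by (auto simp: tilde_def)
  have "closed_segment x (Re2 z) \<inter> frontier B \<noteq> {}"
    using x \<open>Re2 z \<notin> B\<close> by (intro connected_Int_frontier) auto
  then obtain w where w: "w \<in> closed_segment x (Re2 z)" "w \<in> frontier B" by blast
  have "infdist x (frontier B) \<le> dist x w" using w by (intro infdist_le)
  also have "\<dots> \<le> dist x (Re2 z)" using dist_in_closed_segment(1)[OF w(1)] by (simp add: dist_commute)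
  also have "\<dots> \<le> norm (z - emb2 x)" using norm_Re2_diff_le[of z x] by (simp add: dist_norm norm_minus_commute)
  finally show False using x(2) infdist_nonneg[of x "frontier B"] by linarith
qed

text \<open>If all functions on \<open>D\<close> continued across a point \<open>z0\<close> of the complement, so would
  \<open>1 / (l z - l z0)\<close>, but that contradicts the identity theorem for \<open>g * (l - l z0)\<close>.\<close>

lemma domain_of_holomorphyI:
  assumes D: "domain2 D"
    and sep: "\<And>z0. z0 \<notin> D \<Longrightarrow> \<exists>l. holo2 l UNIV \<and> l z0 = 0 \<and> (\<forall>z\<in>D. l z \<noteq> 0)"
  shows "domain_of_holomorphy D"
  unfolding domain_of_holomorphy_def
proof (intro conjI D notI)
  assume "\<exists>U V. open U \<and> connected U \<and> open V \<and> V \<noteq> {} \<and> V \<subseteq> U \<inter> D \<and> \<not> U \<subseteq> D \<and>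
          (\<forall>f. holo2 f D \<longrightarrow> (\<exists>g. holo2 g U \<and> (\<forall>z\<in>V. g z = f z)))"
  then obtain U V where U: "open U" "connected U" and V: "open V" "V \<noteq> {}" "V \<subseteq> U \<inter> D" and "\<not> U \<subseteq> D"
    and ext: "\<And>f. holo2 f D \<Longrightarrow> \<exists>g. holo2 g U \<and> (\<forall>z\<in>V. g z = f z)" by blast
  obtain z0 where z0: "z0 \<in> U" "z0 \<notin> D" using \<open>\<not> U \<subseteq> D\<close> by blast
  obtain l where l: "holo2 l UNIV" "l z0 = 0" "\<And>z. z \<in> D \<Longrightarrow> l z \<noteq> 0" using sep[OF z0(2)] by blast
  have lS: "holo2 l S" for S using l(1) by (rule holo2_subset) simp
  obtain g where g: "holo2 g U" "\<And>z. z \<in> V \<Longrightarrow> g z = inverse (l z)"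
    using ext[OF holo2_inverse[OF lS l(3)]] by blast
  have "g z0 * l z0 = 1"
  proof (rule holo2_identity[OF U V(1,2)])
    show "g z * l z = 1" if "z \<in> V" for z using that g(2) l(3)[of z] V(3) by auto
  qed (use V z0 in \<open>auto intro!: holo2_mult holo2_const g lS\<close>)
  then show False using l(2) by simp
qed

theorem theorem4p14:
  fixes \<mu> :: real
  assumes "\<mu> \<ge> 0"
  shows "is_envelope (tilde (Vmu_plus \<mu>) \<union> Tplus \<union> Tminus)
     (Tplus \<union> Tminus
      \<union> {z. msq (Im2 z) < 0 \<and> mink (Re2 z) (yhat (Im2 z)) > \<mu>}
      \<union> {z. msq (Im2 z) = 0 \<and> Im2 z \<noteq> 0 \<and>
             fst (Re2 z) > snd (Re2 z) * sgn (fst (Im2 z)) * sgn (snd (Im2 z))}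
      \<union> {z. Im2 z = 0 \<and> Re2 z \<in> Vmu_plus \<mu>})"
proof -
  define V where "V = Vmu_plus \<mu>"
  define G where "G = tilde V \<union> Tplus \<union> Tminus"
  define E where "E = lightcone -` lc_envelope \<mu>"
  define B where "B x = ball (emb2 x) (infdist x (frontier V) / 32)" for x
  have V: "open V" "V \<noteq> UNIV"
  proof -
    have "(0, 0) \<notin> V" by (simp add: V_def Vmu_plus_def)
    then show "V \<noteq> UNIV" by blast
  qed (simp add: V_def open_Vmu_plus)
  have emb2_B: "emb2 x \<in> B x" if "x \<in> V" for x
    using infdist_frontier_pos[OF V(1) that V(2)] by (simp add: B_def)
  have tilde_V: "tilde V = (\<Union>x\<in>V. B x)" by (simp add: tilde_eq B_def)
  have T: "open Tplus" "open Tminus" "connected Tplus" "connected Tminus"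
  proof -
    have eqs: "tube_pos = {w. Im w > 0} \<times> {w. Im w > 0}" "tube_neg = {w. Im w < 0} \<times> {w. Im w < 0}"
      by (auto simp: tube_pos_def tube_neg_def)
    have "convex tube_pos" "convex tube_neg"
      unfolding eqs by (intro convex_Times convex_halfspace_Im_gt convex_halfspace_Im_lt)+
    then show "open Tplus" "open Tminus" "connected Tplus" "connected Tminus"
      unfolding Tplus_eq Tminus_eq
      by (simp_all add: open_vimage_lightcone open_tube_pos open_tube_neg connected_vimage_lightcone convex_connected)
  qed
  have "Tplus \<noteq> {}" using tube_pos_nonempty lightcone_lightcone_inv unfolding Tplus_eq by (metis empty_iff vimage_eq)
  have openG: "open G" unfolding G_def tilde_V using T by (auto simp: B_def)
  have E: "open E" "connected E"
    unfolding E_def using open_lc_envelope connected_lc_envelope by (auto intro: open_vimage_lightcone connected_vimage_lightcone)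
  have "Tplus \<subseteq> E" "Tminus \<subseteq> E"
    using tube_pos_subset_lc_envelope tube_neg_subset_lc_envelope unfolding E_def Tplus_eq Tminus_eq by blast+
  \<comment> \<open>\<open>E\<close> contains every point whose real part lies in \<open>V\<close>,
    whatever its imaginary part.\<close>
  have "tilde V \<subseteq> E"
  proof
    fix z assume "z \<in> tilde V"
    then have "Re2 z \<in> Vmu_plus \<mu>" using Re2_tilde unfolding V_def by blast
    then show "z \<in> E" by (simp add: E_def lc_envelope_eq[OF assms] Vmu_plus_iff lightcone_def Re2_def)
  qed
  then have GE: "G \<subseteq> E" using \<open>Tplus \<subseteq> E\<close> \<open>Tminus \<subseteq> E\<close> by (simp add: G_def)
  have dom: "domain_of_holomorphy E"
  proof (rule domain_of_holomorphyI)
    show "domain2 E" using E \<open>Tplus \<noteq> {}\<close> \<open>Tplus \<subseteq> E\<close> by (auto simp: domain2_def)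
    fix z0 assume "z0 \<notin> E"
    then obtain r s c where line: "r \<ge> 0" "s \<ge> 0" "r + s > 0" "c \<le> 2 * \<mu> * sqrt (r * s)"
        "of_real s * fst (lightcone z0) + of_real r * snd (lightcone z0) = of_real c"
      using line_through_complement_lc_envelope[OF assms, of "lightcone z0"] unfolding E_def by (metis vimage_eq)
    show "\<exists>l. holo2 l UNIV \<and> l z0 = 0 \<and> (\<forall>z\<in>E. l z \<noteq> 0)"
    proof (intro exI conjI ballI)
      show "holo2 (\<lambda>z. of_real s * fst (lightcone z) + of_real r * snd (lightcone z) - of_real c) UNIV"
        unfolding lightcone_def fst_conv snd_conv by (intro holo2_intros)
      show "of_real s * fst (lightcone z) + of_real r * snd (lightcone z) - of_real c \<noteq> 0" if "z \<in> E" for z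
        using line_avoids_lc_envelope[OF line(1-4), of "lightcone z"] that by (simp add: E_def)
    qed (use line in simp)
  qed
  have ext: "extends_all G E"
    unfolding extends_all_def
  proof (intro allI impI)
    fix f assume f: "holo2 f G"
    have sub: "tube_pos \<subseteq> lightcone_inv -` G" "tube_neg \<subseteq> lightcone_inv -` G"
      by (auto simp: G_def Tplus_eq Tminus_eq lightcone_lightcone_inv)
    have "(of_real x, of_real y) \<in> lightcone_inv -` G" if "x > 0" "y > 0" "x * y > \<mu>\<^sup>2" for x y
    proof -
      have "((x + y) / 2, (x - y) / 2) \<in> V"
        using that by (simp add: V_def Vmu_plus_iff field_simps)
      then have "emb2 ((x + y) / 2, (x - y) / 2) \<in> G" using emb2_B by (auto simp: G_def tilde_V)
      then show ?thesis by (simp add: lightcone_inv_def emb2_def)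
    qed
    then obtain F0 where F0: "holo2 F0 (lc_envelope \<mu>)" "\<And>w. w \<in> tube_pos \<Longrightarrow> F0 w = f (lightcone_inv w)"
      using lc_envelope_extension[OF holo2_lightcone_inv[OF f] open_vimage[OF openG continuous_on_lightcone_inv] sub] by metis
    define F where "F z = F0 (lightcone z)" for z
    have F: "holo2 F E" unfolding F_def E_def using F0(1) by (rule holo2_lightcone)
    have FTplus: "F z = f z" if "z \<in> Tplus" for z
      using that F0(2) by (simp add: F_def Tplus_eq lightcone_inv_lightcone)
    \<comment> \<open>The shift by plus or minus \<open>d\<close> in the time coordinate has
      timelike imaginary part, so it leads from a real point into both tubes without leaving the
      ball.\<close>
    have meet: "B x \<inter> Tplus \<noteq> {}" "B x \<inter> Tminus \<noteq> {}" if "x \<in> V" for x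
    proof -
      define e where "e = infdist x (frontier V) / 32"
      have e: "e > 0" "ball (emb2 x) e = B x"
        using infdist_frontier_pos[OF V(1) that V(2)] by (simp_all add: e_def B_def)
      define d where "d = complex_of_real (e / 2) * \<i>"
      have nd: "norm d < e" "Im d > 0" using e(1) by (simp_all add: d_def norm_mult)
      have "emb2 x + (d, 0) \<in> ball (emb2 x) e" "emb2 x - (d, 0) \<in> ball (emb2 x) e"
        using nd by (simp_all add: dist_norm norm_Pair)
      moreover have "emb2 x + (d, 0) \<in> Tplus" "emb2 x - (d, 0) \<in> Tminus"
        using nd by (simp_all add: Tplus_eq Tminus_eq tube_pos_def tube_neg_def lightcone_def emb2_def)
      ultimately show "B x \<inter> Tplus \<noteq> {}" "B x \<inter> Tminus \<noteq> {}" unfolding e(2) by blast+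
    qed
    have BG: "B x \<subseteq> G" if "x \<in> V" for x using that by (auto simp: G_def tilde_V)
    \<comment> \<open>Agreement spreads from the forward tube to each ball by the identity
      theorem.\<close>
    have FB: "F z = f z" if "x \<in> V" "z \<in> B x" for x z
    proof (rule holo2_identity[of "B x" "B x \<inter> Tplus"])
      show "holo2 F (B x)" "holo2 f (B x)"
        using BG[OF that(1)] GE by (simp_all add: holo2_subset[OF F] holo2_subset[OF f])
    qed (use meet[OF that(1)] T FTplus that in \<open>auto simp: B_def\<close>)
    obtain x0 where x0: "x0 \<in> V"
    proof
      show "(\<mu> + 1, 0) \<in> V" using assms by (simp add: V_def Vmu_plus_iff power2_eq_square algebra_simps)
    qed
    \<comment> \<open>A single ball then serves as the bridge to the backward tube.\<close>
    have FTminus: "F z = f z" if "z \<in> Tminus" for z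
    proof (rule holo2_identity[of Tminus "B x0 \<inter> Tminus"])
      show "holo2 F Tminus" "holo2 f Tminus"
        using holo2_subset[OF F \<open>Tminus \<subseteq> E\<close>] holo2_subset[OF f] by (auto simp: G_def)
    qed (use meet[OF x0] T FB[OF x0] that in \<open>auto simp: B_def\<close>)
    have "F z = f z" if "z \<in> G" for z
      using that FTplus FTminus FB unfolding G_def tilde_V by blast
    with F show "\<exists>F. holo2 F E \<and> (\<forall>z\<in>G. F z = f z)" by blast
  qed
  \<comment> \<open>Otherwise \<open>E\<close>, with the open set \<open>Tplus\<close>, would
    witness that \<open>D\<close> is no domain of holomorphy: each function on \<open>D\<close>
    restricts to \<open>G\<close> and extends from there to \<open>E\<close>.\<close>
  have "E \<subseteq> D" if D: "domain_of_holomorphy D" "G \<subseteq> D" for D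
  proof (rule ccontr)
    assume "\<not> E \<subseteq> D"
    have "Tplus \<subseteq> G" unfolding G_def by blast
    have restr: "\<exists>g. holo2 g E \<and> (\<forall>z\<in>Tplus. g z = f z)" if "holo2 f D" for f
    proof -
      have "holo2 f G" using that D(2) by (rule holo2_subset)
      then obtain g where "holo2 g E" "\<forall>z\<in>G. g z = f z"
        using ext unfolding extends_all_def by blast
      then show ?thesis using \<open>Tplus \<subseteq> G\<close> by (intro exI[of _ g] conjI) auto
    qed
    have "Tplus \<subseteq> E \<inter> D" using \<open>Tplus \<subseteq> G\<close> GE D(2) by (intro Int_greatest) simp_all
    show False
    proof (rule notE[OF conjunct2[OF D(1)[unfolded domain_of_holomorphy_def]]], rule exI[of _ E],
        rule exI[of _ Tplus], intro conjI)
      show "\<forall>f. holo2 f D \<longrightarrow> (\<exists>g. holo2 g E \<and> (\<forall>z\<in>Tplus. g z = f z))" using restr by blast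
    qed fact+
  qed
  then have "is_envelope G E" using GE dom ext unfolding is_envelope_def by blast
  then show ?thesis unfolding G_def E_def V_def envelope_set_eq[OF assms] .
qed

end
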